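(* Let $(\xi_j)_{j\ge 0}$ be independent, identically distributed random variables taking values in $\{-1,0,1\}$, and for $n\ge 1$ let $P(z):=\sum_{j=0}^n \xi_j z^j$. For $z\in\mathbb{C}$ let $D_z$ be the event that $z$ is a double root of $P$. If \[\max_{x\in\{-1,0,1\}} \mathbb{P}(\xi_0 = x) < \frac{1}{\sqrt{3}},\] then \[\mathbb{P}(P\text{ has a double root}) = \mathbb{P}\Big(\bigcup_{z\in\mathbb{C}} D_z\Big)=\mathbb{P}(D_{-1}\cup D_0\cup D_1) + o(n^{-2})\quad\text{as } n\to\infty.\]
   Context: Here $o(n^{-2})$ denotes a term $\delta_n$, where the sequence $(\delta_n)$ depends only on the distribution of $\xi_0$ and satisfies $\lim_{n\to\infty}\delta_n n^{2}=0$. A double root of $P$ means a root of multiplicity at least $2$. *)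

theory Defs
  imports "HOL-Probability.Probability" "HOL-Computational_Algebra.Polynomial"
begin

definition rand_poly :: "nat \<Rightarrow> (nat \<Rightarrow> int) \<Rightarrow> complex poly" where
  "rand_poly n f = (\<Sum>j\<le>n. monom (of_int (f j)) j)"

definition double_root :: "complex poly \<Rightarrow> complex \<Rightarrow> bool" where
  "double_root p z \<longleftrightarrow> [:-z, 1:] ^ 2 dvd p"

definition coeff_law :: "int pmf \<Rightarrow> nat \<Rightarrow> (nat \<Rightarrow> int) pmf" where
  "coeff_law d n = Pi_pmf {..n} 0 (\<lambda>_. d)"

end

(* Let z be a double root of P outside {-1, 0, 1}, and assume that none of -1, 0, 1 is a double root.
   Then z is a root of some monic m in Z[x] with m^2 dvd P, |m(0)| = 1, degree k >= 2, and all roots of m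
   lie in 1/2 < |z| < 2. Four cases, with p the largest atom and D of order ln n:

   k >= D: since (3 - r) r >= 5/4 on [1/2, 2] and the roots have product of modulus 1, |m(3)| >= (5/4)^k.
   The square of |m(3)| divides P(3), and P(3) has balanced ternary digits, so a divisor q >= 3^J has
   probability at most p^J. Summing over squares q converges precisely because p < 1/sqrt 3.

   k < D and m has a root of modulus at most 1/(1 + 1/k): the coefficients in positions divisible by 2k are
   determined by the others, so P(z) = 0 is exponentially unlikely compared with the number of such m.

   3 <= k < D and all roots have modulus at least 1/(1 + 1/k): m is determined by the Newton sums of the
   inverse roots, which are integers of size at most 3k, so there are at most 2 (6k + 1)^k such m. Reducing
   m^2 dvd P modulo A ~ n^(2/5), Fourier analysis bounds its probability by A^(-2k) up to a tiny error.

   k = 2 and all roots have modulus greater than 2/3: m is x^2 + 1 or x^2 + x + 1 or x^2 - x + 1, and m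
   divides both P and x P'. Reducing the first modulo n^(1/4) and the second modulo an integer of order n gives
   probability O(n^(-5/2)). *)

theory Submission
  imports Defs "HOL-Computational_Algebra.Polynomial_FPS"
    "HOL-Computational_Algebra.Fundamental_Theorem_Algebra" "HOL-Real_Asymp.Real_Asymp"
begin

section \<open>Integer polynomials and their double roots\<close>

text \<open>The proof is a union bound over the possible factors m, so each range of degrees is
  governed by how well such m can be counted. If roots are only known to exceed 1/2, the Newton sums
  allow exp(O(k^2)) polynomials of degree k. For large k this is too many, and the union is taken
  over the integers m(3)^2 instead; for k of order ln n it is harmless, but only against an
  exponentially small probability. With a single modulus A, the Fourier error exp(-c n / (k A^2))
  forces A^2 below n, so that m^2 dvd P costs at best about n^(-k). This suffices for k >= 3, where
  A ~ n^(2/5) gives n^(-12/5) up to logarithms, but not for k = 2. There the multiplicity has to be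
  exploited through x P': its coefficients carry the weights j, which spread over the residues of a
  modulus as large as order n. Moduli are odd because the characteristic function of a law on {-1,
  1} has modulus 1 at every multiple of pi, so the available decay is only in sin^2 t.\<close>

abbreviation cpoly :: "int poly \<Rightarrow> complex poly" where
  "cpoly \<equiv> map_poly of_int"

lemma coeff_cpoly [simp]: "coeff (cpoly p) i = of_int (coeff p i)"
  by (simp add: coeff_map_poly)

lemma cpoly_add: "cpoly (p + q) = cpoly p + cpoly q"
  by (simp add: poly_eq_iff)

lemma cpoly_mult: "cpoly (p * q) = cpoly p * cpoly q"
  by (simp add: poly_eq_iff coeff_mult)

lemma cpoly_power: "cpoly (p ^ k) = cpoly p ^ k"
  by (induction k) (simp_all add: cpoly_mult)

lemma cpoly_smult: "cpoly (smult c p) = smult (of_int c) (cpoly p)"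
  by (simp add: poly_eq_iff)

lemma cpoly_pderiv: "cpoly (pderiv p) = pderiv (cpoly p)"
  by (simp add: poly_eq_iff coeff_pderiv)

lemma cpoly_sum: "cpoly (sum f A) = (\<Sum>x\<in>A. cpoly (f x))"
  by (induction A rule: infinite_finite_induct) (simp_all add: cpoly_add)

lemma cpoly_eq_0_iff [simp]: "cpoly p = 0 \<longleftrightarrow> p = 0"
  by (simp add: poly_eq_iff)

lemma degree_cpoly [simp]: "degree (cpoly p) = degree p"
  by (rule degree_map_poly) auto

lemma poly_cpoly_of_int [simp]: "poly (cpoly p) (of_int k) = of_int (poly p k)"
  by (induction p) (simp_all add: map_poly_pCons)

lemma poly_cpoly_numeral:
  "poly (cpoly p) (numeral w) = of_int (poly p (numeral w))"
  "poly (cpoly p) 0 = of_int (poly p 0)"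
  "poly (cpoly p) 1 = of_int (poly p 1)"
  "poly (cpoly p) (-1) = of_int (poly p (-1))"
  using poly_cpoly_of_int[of p "numeral w"] poly_cpoly_of_int[of p 0]
    poly_cpoly_of_int[of p 1] poly_cpoly_of_int[of p "-1"] by simp_all

text \<open>Gauss's lemma: \<open>content\<close> is multiplicative, so the cofactor of the
  primitive \<open>g\<close> has the content of \<open>smult a f\<close> and absorbs the factor
  \<open>a\<close>.\<close>

lemma primitive_dvd_smultD:
  fixes f g :: "int poly"
  assumes "content g = 1" "a \<noteq> 0" "g dvd smult a f"
  shows "g dvd f"
proof -
  obtain q where q: "smult a f = g * q" using assms(3) by (elim dvdE)
  have "a dvd content q"
  proof -
    have "content (smult a f) = content q" using assms(1) by (simp add: q content_mult)
    then show ?thesis by (metis content_smult dvd_mult2 dvd_normalize_iff dvd_refl)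
  qed
  then obtain q' where q': "q = smult a q'"
  proof -
    have "[:a:] dvd q" using \<open>a dvd content q\<close> by (simp add: const_poly_dvd_iff_dvd_content)
    then show ?thesis using that by (elim dvdE) auto
  qed
  have "smult a f = smult a (g * q')" by (simp add: q q')
  then have "f = g * q'" using assms(2) by (metis smult_cancel)
  then show ?thesis by simp
qed

text \<open>Up to a constant, \<open>g\<close> is the minimal polynomial of \<open>z\<close>: a
  primitive integer polynomial of least degree vanishing there. By pseudo-division and Gauss's lemma
  it divides every integer polynomial vanishing at \<open>z\<close>. Since \<open>pderiv g\<close>
  has smaller degree, \<open>z\<close> is a simple root of \<open>g\<close>; hence \<open>z\<close>
  is still a root of the cofactor \<open>h\<close>, and \<open>g\<close> divides a second
  time.\<close>

lemma cpoly_double_root_factor: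
  assumes p: "p \<noteq> 0" and z: "[:-z, 1:] ^ 2 dvd cpoly p"
  obtains g where "g ^ 2 dvd p" "degree g \<ge> 1" "poly (cpoly g) z = 0"
proof -
  define S where "S g \<longleftrightarrow> g \<noteq> 0 \<and> poly (cpoly g) z = 0" for g :: "int poly"
  obtain r where r: "cpoly p = [:-z, 1:] ^ 2 * r" using z by (elim dvdE)
  have pz: "poly (cpoly p) z = 0" by (simp add: r)
  have dpz: "poly (cpoly (pderiv p)) z = 0"
    unfolding cpoly_pderiv r by (simp only: pderiv_mult power2_eq_square poly_add poly_mult) simp
  have Sp: "S p" using p pz by (simp add: S_def)
  obtain g0 where g0: "S g0" "\<And>g. S g \<Longrightarrow> degree g0 \<le> degree g"
    using exists_least_iff[of "\<lambda>n. \<exists>g. S g \<and> degree g = n"] Sp by (metis linorder_not_less)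
  define g where "g = primitive_part g0"
  have g0eq: "g0 = smult (content g0) g" by (simp add: g_def)
  have cg: "content g = 1" using g0 by (simp add: g_def S_def)
  have Sg: "S g" using g0(1) unfolding S_def
    by (metis cpoly_smult g0eq mult_eq_0_iff of_int_eq_0_iff poly_smult smult_0_right smult_0_left)
  have degg: "degree g \<le> degree h" if "S h" for h using g0(2)[OF that] by (simp add: g_def)
  have dvd: "g dvd h" if h: "poly (cpoly h) z = 0" for h
  proof -
    have gn: "g \<noteq> 0" using Sg by (simp add: S_def)
    obtain a q where aq: "a \<noteq> 0" "smult a h = g * q + pseudo_mod h g"
      using pseudo_mod(1)[OF gn] by blast
    have "poly (cpoly (smult a h)) z = poly (cpoly (g * q + pseudo_mod h g)) z" by (simp only: aq)
    then have "poly (cpoly (pseudo_mod h g)) z = 0"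
      using h Sg by (simp add: cpoly_smult cpoly_add cpoly_mult S_def)
    then have "pseudo_mod h g = 0"
      using degg[of "pseudo_mod h g"] pseudo_mod(2)[OF gn, of h] by (force simp: S_def)
    then have "g dvd smult a h" using aq by simp
    then show ?thesis using primitive_dvd_smultD[OF cg aq(1)] by simp
  qed
  have d1: "degree g \<ge> 1"
  proof (rule ccontr)
    assume "\<not> ?thesis"
    then obtain c where c: "g = [:c:]" by (metis degree_eq_zeroE not_less_eq_eq le_zero_eq One_nat_def)
    then show False using Sg by (auto simp: S_def map_poly_pCons)
  qed
  obtain h where h: "p = g * h" using dvd[OF pz] by (elim dvdE)
  have gd: "poly (cpoly (pderiv g)) z \<noteq> 0"
  proof
    assume *: "poly (cpoly (pderiv g)) z = 0"
    have "pderiv g \<noteq> 0" using d1 by (simp add: pderiv_eq_0_iff)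
    then have "S (pderiv g)" using * by (simp add: S_def)
    then have "degree g \<le> degree (pderiv g)" by (rule degg)
    then show False using d1 by (simp add: degree_pderiv)
  qed
  have "poly (cpoly h) z = 0"
    using dpz gd Sg by (simp add: h pderiv_mult cpoly_add cpoly_mult S_def)
  then have "g dvd h" by (rule dvd)
  then have "g ^ 2 dvd p" by (simp add: h power2_eq_square)
  then show ?thesis using that d1 Sg by (auto simp: S_def)
qed

lemma monom_sum_coeff: "coeff (\<Sum>j\<le>n. monom (f j) j) i = (if i \<le> n then f i else 0)"
  by (simp add: coeff_sum coeff_monom)

lemma cpoly_monom: "cpoly (monom c j) = monom (of_int c) j"
  by (simp add: poly_eq_iff)

definition int_rand_poly :: "nat \<Rightarrow> (nat \<Rightarrow> int) \<Rightarrow> int poly" where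
  "int_rand_poly n f = (\<Sum>j\<le>n. monom (f j) j)"

lemma coeff_int_rand_poly: "coeff (int_rand_poly n f) i = (if i \<le> n then f i else 0)"
  by (simp add: int_rand_poly_def monom_sum_coeff)

lemma rand_poly_eq: "rand_poly n f = cpoly (int_rand_poly n f)"
  by (simp add: rand_poly_def int_rand_poly_def cpoly_sum cpoly_monom)

section \<open>Location of the roots, and reduction to a monic square factor with unit constant
  term\<close>

lemma norm_root_less_2:
  fixes p :: "complex poly"
  assumes "p \<noteq> 0" "\<And>i. norm (coeff p i) \<le> 1" "norm (lead_coeff p) = 1" "poly p z = 0"
  shows "norm z < 2"
proof (rule ccontr)
  assume *: "\<not> ?thesis"
  define N where "N = degree p"
  \<comment> \<open>For |z| >= 2 the geometric sum is at most |z|^N - 1, so the leading term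
    outweighs all the others.\<close>
  have g: "(\<Sum>i<N. norm z ^ i) < norm z ^ N"
  proof -
    have "(norm z - 1) * (\<Sum>i<N. norm z ^ i) = norm z ^ N - 1"
      using power_diff_1_eq[of "norm z" N] by simp
    moreover have "(\<Sum>i<N. norm z ^ i) \<ge> 0" by (intro sum_nonneg) auto
    moreover have "1 * (\<Sum>i<N. norm z ^ i) \<le> (norm z - 1) * (\<Sum>i<N. norm z ^ i)"
      using * \<open>(\<Sum>i<N. norm z ^ i) \<ge> 0\<close> by (intro mult_right_mono) auto
    ultimately show ?thesis by linarith
  qed
  have "poly p z = (\<Sum>i<N. coeff p i * z ^ i) + coeff p N * z ^ N"
    by (simp add: poly_altdef N_def lessThan_Suc_atMost[symmetric])
  then have "coeff p N * z ^ N = - (\<Sum>i<N. coeff p i * z ^ i)"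
    using assms(4) by (simp add: eq_neg_iff_add_eq_0 add.commute)
  then have "norm (coeff p N * z ^ N) = norm (\<Sum>i<N. coeff p i * z ^ i)" by (metis norm_minus_cancel)
  also have "\<dots> \<le> (\<Sum>i<N. norm (coeff p i * z ^ i))" by (rule norm_sum)
  also have "\<dots> \<le> (\<Sum>i<N. norm z ^ i)"
    using assms(2) by (intro sum_mono) (simp add: norm_mult norm_power mult_left_le_one_le)
  finally show False using g assms(3) by (simp add: norm_mult norm_power N_def)
qed

text \<open>Reversing the coefficients exchanges \<open>z\<close> with its inverse. The power of x
  is split off first, so that the lowest nonzero coefficient becomes the leading one.\<close>

lemma norm_root_greater_half:
  fixes p :: "complex poly"
  assumes "p \<noteq> 0" "\<And>i. norm (coeff p i) \<le> 1" "\<And>i. coeff p i \<noteq> 0 \<Longrightarrow> norm (coeff p i) = 1"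
    and "poly p z = 0" "z \<noteq> 0"
  shows "norm z > 1 / 2"
proof -
  obtain k q where q: "p = [:0, 1:] ^ k * q" "\<not> [:0, 1:] dvd q"
    using order_decomp[OF assms(1), of 0] by auto
  have pq: "p = monom 1 k * q" by (simp add: q(1) monom_altdef)
  have cq: "coeff q i = coeff p (i + k)" for i by (simp add: pq coeff_monom_mult)
  have q0: "coeff q 0 \<noteq> 0" using q(2) by (metis poly_0_coeff_0 poly_eq_0_iff_dvd minus_zero)
  then have qn: "q \<noteq> 0" by auto
  have qz: "poly q z = 0" using assms(4,5) by (simp add: pq poly_monom)
  have "norm (inverse z) < 2"
  proof (rule norm_root_less_2[of "reflect_poly q"])
    show "reflect_poly q \<noteq> 0" using qn by simp
    show "norm (coeff (reflect_poly q) i) \<le> 1" for i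
      using assms(2) by (simp add: coeff_reflect_poly cq)
    show "norm (lead_coeff (reflect_poly q)) = 1"
      using assms(3)[of k] q0 by (simp add: coeff_reflect_poly cq)
    show "poly (reflect_poly q) (inverse z) = 0"
      using qz assms(5) by (simp add: poly_reflect_poly_nz)
  qed
  then show ?thesis using assms(5) unfolding norm_inverse by (simp add: inverse_eq_divide divide_simps norm_divide del: one_less_inverse_iff)
qed

text \<open>The unit constant term makes the inverse roots algebraic integers, and it lets the
  linear recurrence attached to \<open>m\<close> run backwards modulo any integer.\<close>

definition unit_poly :: "int poly \<Rightarrow> bool" where
  "unit_poly m \<longleftrightarrow> lead_coeff m = 1 \<and> \<bar>coeff m 0\<bar> = 1 \<and>
     (\<forall>z. poly (cpoly m) z = 0 \<longrightarrow> 1 / 2 < norm z \<and> norm z < 2)"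

lemma dvd_1_if_square_mult:
  fixes a b c :: int
  assumes "c = a ^ 2 * b" "c = 1 \<or> c = -1"
  shows "a dvd 1"
proof -
  have "a dvd c" by (simp add: assms(1) power2_eq_square)
  then show ?thesis using assms(2) by (elim disjE) (simp_all only: dvd_minus_iff)
qed

lemma double_root_factor:
  assumes f: "\<And>j. f j \<in> {-1, 0, 1}"
    and z: "double_root (rand_poly n f) z"
    and no: "\<not> (\<exists>z\<in>{-1, 0, 1}. double_root (rand_poly n f) z)"
  obtains m where "unit_poly m" "m ^ 2 dvd int_rand_poly n f" "degree m \<ge> 2"
    "poly m 1 \<noteq> 0" "poly m (-1) \<noteq> 0"
proof -
  define p where "p = int_rand_poly n f"
  have rp: "rand_poly n f = cpoly p" by (simp add: rand_poly_eq p_def)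
  have cp: "coeff p i \<in> {-1, 0, 1}" for i using f[of i] by (auto simp: p_def coeff_int_rand_poly)
  have p0: "p \<noteq> 0"
  proof
    assume "p = 0"
    then have "double_root (rand_poly n f) 0" by (simp add: rp double_root_def)
    then show False using no by auto
  qed
  obtain g where g: "g ^ 2 dvd p" "degree g \<ge> 1" "poly (cpoly g) z = 0"
    using cpoly_double_root_factor[OF p0] z unfolding double_root_def rp by blast
  obtain h where h: "p = g ^ 2 * h" using g(1) by (elim dvdE)
  have "lead_coeff p = lead_coeff g ^ 2 * lead_coeff h"
    by (simp add: h lead_coeff_mult lead_coeff_power)
  moreover have "lead_coeff p = 1 \<or> lead_coeff p = -1" using cp[of "degree p"] p0 by auto
  ultimately have "lead_coeff g dvd 1" by (rule dvd_1_if_square_mult)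
  then have lg: "lead_coeff g = 1 \<or> lead_coeff g = -1" by auto
  define m where "m = smult (lead_coeff g) g"
  have m2: "m ^ 2 = g ^ 2" using lg by (auto simp: m_def)
  have mp: "p = m ^ 2 * h" using m2 h by simp
  have lm: "lead_coeff m = 1" using lg by (auto simp: m_def)
  have dm: "degree m \<ge> 1" using g(2) lg by (auto simp: m_def)
  have nr: "poly m k \<noteq> 0" if k: "k \<in> {-1, 0, 1}" for k
  proof
    assume "poly m k = 0"
    then have "poly (cpoly m) (of_int k) = 0" by simp
    then have "[:- of_int k, 1:] dvd cpoly m" by (simp only: poly_eq_0_iff_dvd)
    then have "[:- of_int k, 1:] ^ 2 dvd cpoly m ^ 2" by (rule dvd_power_same)
    then have "double_root (rand_poly n f) (of_int k)"
      by (simp add: rp mp double_root_def cpoly_mult cpoly_power)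
    then show False using no k by auto
  qed
  have m0: "coeff m 0 \<noteq> 0" using nr[of 0] by (simp add: poly_0_coeff_0)
  have am0: "\<bar>coeff m 0\<bar> = 1"
  proof -
    have "coeff m 0 dvd 1"
    proof (cases "coeff p 0 = 0")
      case False
      have "coeff p 0 = coeff m 0 ^ 2 * coeff h 0" by (simp add: mp coeff_mult power2_eq_square)
      moreover have "coeff p 0 = 1 \<or> coeff p 0 = -1" using False cp[of 0] by auto
      ultimately show ?thesis by (rule dvd_1_if_square_mult)
    next
      \<comment> \<open>Here 0 is a simple root of \<open>p\<close>, so the coefficient of x takes
        over the role of the constant term: it is nonzero and equals
        \<open>coeff m 0 ^ 2 * coeff h 1\<close>.\<close>
      case True
      have "coeff p 0 = coeff m 0 ^ 2 * coeff h 0" by (simp add: mp coeff_mult power2_eq_square)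
      then have h0: "coeff h 0 = 0" using True m0 by simp
      have p1: "coeff p 1 = coeff m 0 ^ 2 * coeff h 1"
        by (simp add: mp coeff_mult power2_eq_square h0)
      have "coeff p 1 \<noteq> 0"
      proof
        assume "coeff p 1 = 0"
        then have "coeff h 1 = 0" using p1 m0 by simp
        then have "[:0, 1:] ^ 2 dvd cpoly p"
          using True \<open>coeff p 1 = 0\<close> monom_1_dvd_iff'[of 2 "cpoly p"]
          by (auto simp: monom_altdef less_2_cases_iff)
        then have "double_root (rand_poly n f) 0" by (simp add: rp double_root_def)
        then show False using no by auto
      qed
      then have "coeff p 1 = 1 \<or> coeff p 1 = -1" using cp[of 1] by auto
      then show ?thesis by (rule dvd_1_if_square_mult[OF p1])
    qed
    then show ?thesis by simp
  qed
  have roots: "1 / 2 < norm w \<and> norm w < 2" if w: "poly (cpoly m) w = 0" for w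
  proof -
    have 1: "cpoly p \<noteq> 0" using p0 by simp
    have 2: "norm (coeff (cpoly p) i) \<le> 1" for i using cp[of i] by auto
    have 3: "norm (coeff (cpoly p) i) = 1" if "coeff (cpoly p) i \<noteq> 0" for i
      using that cp[of i] by auto
    have 4: "poly (cpoly p) w = 0" using w by (simp add: mp cpoly_mult cpoly_power)
    have 5: "w \<noteq> 0" using w m0 by (auto simp: poly_0_coeff_0)
    show ?thesis using norm_root_less_2[OF 1 2 _ 4] norm_root_greater_half[OF 1 2 3 4 5] 3 p0 by auto
  qed
  \<comment> \<open>A monic linear factor with unit constant term has the root 1 or -1, and both are
    excluded.\<close>
  have "degree m \<noteq> 1"
  proof
    assume "degree m = 1"
    then have "m = [:coeff m 0, 1:]" using lm
      by (intro poly_eqI) (auto simp: coeff_pCons coeff_eq_0 split: nat.splits)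
    then have "poly m x = coeff m 0 + x" for x by (metis poly_pCons poly_0 add_0_right mult_1_right mult_zero_right)
    then have "poly m (- coeff m 0) = 0" by simp
    moreover have "coeff m 0 = 1 \<or> coeff m 0 = -1" using am0 by auto
    ultimately show False using nr[of 1] nr[of "-1"] by auto
  qed
  then have "degree m \<ge> 2" using dm by simp
  moreover have "unit_poly m" using lm am0 roots by (simp add: unit_poly_def)
  ultimately show ?thesis using that[of m] nr mp by (auto simp: p_def)
qed

section \<open>Events that determine some of the coefficients\<close>

lemma set_coeff_law: "set_pmf (coeff_law d n) = PiE_dflt {..n} 0 (\<lambda>_. set_pmf d)"
  by (simp add: coeff_law_def set_Pi_pmf o_def)

text \<open>On \<open>E\<close> the coefficients at \<open>I\<close> are functions of the others, so
  erasing them is injective; each erased coordinate contributes a factor at most \<open>p\<close> to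
  the mass of an outcome.\<close>

lemma prob_coordinates_determined_le:
  fixes d :: "int pmf"
  assumes fin: "finite (set_pmf d)" and I: "I \<subseteq> {..n}" and p: "\<And>x. pmf d x \<le> p"
    and det: "\<And>f g. f \<in> E \<Longrightarrow> g \<in> E \<Longrightarrow> f \<in> set_pmf (coeff_law d n) \<Longrightarrow> g \<in> set_pmf (coeff_law d n) \<Longrightarrow>
      (\<And>j. j \<notin> I \<Longrightarrow> f j = g j) \<Longrightarrow> f = g"
  shows "measure_pmf.prob (coeff_law d n) E \<le> p ^ card I"
proof -
  define E' where "E' = E \<inter> set_pmf (coeff_law d n)"
  define Q where "Q = Pi_pmf ({..n} - I) 0 (\<lambda>_. d)"
  \<comment> \<open>Erased coordinates get 0, the default value of \<open>Pi_pmf\<close>, so that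
    the product formula for \<open>Q\<close> applies to \<open>r f\<close>.\<close>
  define r where "r f = (\<lambda>j. if j \<in> I then 0 else f j)" for f :: "nat \<Rightarrow> int"
  have finI: "finite I" using I finite_subset by blast
  have p0: "0 \<le> p" using p[of 0] pmf_nonneg[of d 0] by linarith
  have finE: "finite E'" unfolding E'_def set_coeff_law using fin by (auto intro: finite_PiE_dflt)
  have inj: "inj_on r E'"
  proof (rule inj_onI)
    fix f g assume *: "f \<in> E'" "g \<in> E'" "r f = r g"
    have "f j = g j" if "j \<notin> I" for j using fun_cong[OF *(3), of j] that by (simp add: r_def)
    then show "f = g" using * det[of f g] by (auto simp: E'_def)
  qed
  have le: "pmf (coeff_law d n) f \<le> p ^ card I * pmf Q (r f)" if f: "f \<in> E'" for f
  proof -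
    have f0: "f j = 0" if "j > n" for j
      using f that by (auto simp: E'_def set_coeff_law PiE_dflt_def)
    have "pmf (coeff_law d n) f = (\<Prod>j\<in>{..n}. pmf d (f j))"
      unfolding coeff_law_def by (rule pmf_Pi') (auto simp: f0)
    also have "\<dots> = (\<Prod>j\<in>I. pmf d (f j)) * (\<Prod>j\<in>{..n} - I. pmf d (f j))"
      using prod.subset_diff[OF I] by (simp add: mult.commute)
    also have "(\<Prod>j\<in>{..n} - I. pmf d (f j)) = (\<Prod>j\<in>{..n} - I. pmf d (r f j))"
      by (rule prod.cong) (auto simp: r_def)
    also have "\<dots> = pmf Q (r f)"
      unfolding Q_def by (rule pmf_Pi'[symmetric]) (auto simp: f0 r_def)
    also have "(\<Prod>j\<in>I. pmf d (f j)) * pmf Q (r f) \<le> (\<Prod>j\<in>I. p) * pmf Q (r f)"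
      by (intro mult_right_mono prod_mono) (auto simp: p)
    finally show ?thesis by simp
  qed
  have "measure_pmf.prob (coeff_law d n) E = measure_pmf.prob (coeff_law d n) E'"
    by (simp add: E'_def measure_Int_set_pmf)
  also have "\<dots> = (\<Sum>f\<in>E'. pmf (coeff_law d n) f)" by (rule measure_measure_pmf_finite[OF finE])
  also have "\<dots> \<le> (\<Sum>f\<in>E'. p ^ card I * pmf Q (r f))" by (intro sum_mono le)
  also have "\<dots> = p ^ card I * (\<Sum>g\<in>r ` E'. pmf Q g)"
    by (simp add: sum_distrib_left sum.reindex[OF inj])
  also have "(\<Sum>g\<in>r ` E'. pmf Q g) = measure_pmf.prob Q (r ` E')"
    using finE by (intro measure_measure_pmf_finite[symmetric]) auto
  also have "p ^ card I * \<dots> \<le> p ^ card I * 1"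
    using p0 by (intro mult_left_mono) auto
  finally show ?thesis by simp
qed

text \<open>Differences of digits in {-1, 0, 1} are bounded by 2, whence the bound here and in the next two lemmas.\<close>

lemma ternary_sum_eq_0:
  fixes c :: "nat \<Rightarrow> int"
  assumes "\<And>j. \<bar>c j\<bar> \<le> 2" "(\<Sum>j<J. c j * 3 ^ j) = 0" "j < J"
  shows "c j = 0"
  using assms
proof (induction J arbitrary: c j)
  case (Suc J)
  have eq: "c 0 + 3 * (\<Sum>j<J. c (Suc j) * 3 ^ j) = 0"
    using Suc.prems(2) by (simp add: sum.lessThan_Suc_shift sum_distrib_left mult_ac del: sum.lessThan_Suc)
  then have c0: "c 0 = 0" using Suc.prems(1)[of 0] by presburger
  show ?case
  proof (cases j)
    case (Suc i)
    then show ?thesis using Suc.IH[of "\<lambda>j. c (Suc j)" i] Suc.prems eq c0 by auto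
  qed (use c0 in auto)
qed auto

lemma ternary_sum_abs_less:
  fixes c :: "nat \<Rightarrow> int"
  assumes "\<And>j. \<bar>c j\<bar> \<le> 2"
  shows "\<bar>\<Sum>j<J. c j * 3 ^ j\<bar> < 3 ^ J"
proof (induction J)
  case (Suc J)
  have "\<bar>c J * 3 ^ J\<bar> \<le> 2 * 3 ^ J" using assms[of J] by (simp add: abs_mult)
  then show ?case using Suc by (simp add: algebra_simps)
qed auto

text \<open>The terms after the first add up to at most 1/4 * 8/3 < 1 in modulus, so the integer
  \<open>c 0\<close> vanishes; dividing by \<open>b\<close> then shifts the sequence.\<close>

lemma power_series_int_eq_0:
  fixes c :: "nat \<Rightarrow> int" and b :: complex
  assumes "\<And>j. \<bar>c j\<bar> \<le> 2" "b \<noteq> 0" "norm b \<le> 1 / 4" "(\<Sum>j<J. of_int (c j) * b ^ j) = 0" "j < J"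
  shows "c j = 0"
  using assms(1,4,5)
proof (induction J arbitrary: c j)
  case (Suc J)
  define S where "S = (\<Sum>j<J. of_int (c (Suc j)) * b ^ j)"
  have eq: "of_int (c 0) + b * S = 0"
    using Suc.prems(2) unfolding S_def
    by (simp add: sum.lessThan_Suc_shift sum_distrib_left mult_ac del: sum.lessThan_Suc)
  have "norm S \<le> (\<Sum>j<J. 2 * (1 / 4) ^ j)"
    unfolding S_def
  proof (rule sum_norm_le)
    fix j
    have "\<bar>real_of_int (c (Suc j))\<bar> \<le> 2" using Suc.prems(1)[of "Suc j"] by linarith
    then show "norm (of_int (c (Suc j)) * b ^ j) \<le> 2 * (1 / 4) ^ j"
      using assms(3) by (simp add: norm_mult norm_power mult_mono power_mono del: power_one_over)
  qed
  also have "\<dots> = 2 * (\<Sum>j<J. (1 / 4) ^ j)" by (simp add: sum_distrib_left)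
  also have "(\<Sum>j<J. (1 / 4 :: real) ^ j) = (1 - (1 / 4) ^ J) / (1 - 1 / 4)"
    by (subst sum_gp_strict) auto
  also have "2 * \<dots> \<le> 8 / 3" by simp
  finally have "norm b * norm S \<le> 1 / 4 * (8 / 3)" using assms(3) by (intro mult_mono) auto
  moreover have "norm (of_int (c 0) :: complex) = norm b * norm S"
    using eq by (metis add_eq_0_iff norm_minus_cancel norm_mult)
  ultimately have "\<bar>real_of_int (c 0)\<bar> < 1" by simp
  then have c0: "c 0 = 0" by linarith
  then have S0: "S = 0" using eq assms(2) by simp
  show ?case
  proof (cases j)
    case (Suc i)
    then show ?thesis using Suc.IH[of "\<lambda>j. c (Suc j)" i] Suc.prems S0 S_def by auto
  qed (use c0 in auto)
qed auto

lemma coeff_law_supp: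
  assumes "set_pmf d \<subseteq> {-1, 0, 1}" "f \<in> set_pmf (coeff_law d n)"
  shows "f j \<in> {-1, 0, 1}" "j > n \<Longrightarrow> f j = 0"
  using assms by (force simp: set_coeff_law PiE_dflt_def)+

lemma coeff_law_diff_le:
  assumes "set_pmf d \<subseteq> {-1, 0, 1}" "f \<in> set_pmf (coeff_law d n)" "g \<in> set_pmf (coeff_law d n)"
  shows "\<bar>f j - g j\<bar> \<le> 2"
  using coeff_law_supp(1)[OF assms(1,2), of j] coeff_law_supp(1)[OF assms(1,3), of j] by auto

text \<open>If two outcomes agree from position \<open>J\<close> on, their values at 3 differ by a
  multiple of \<open>q\<close> that is smaller than 3^J <= q, hence by 0, and the first
  \<open>J\<close> digits agree by uniqueness.\<close>

lemma prob_dvd_eval_3_le: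
  fixes d :: "int pmf" and q :: int
  assumes d: "set_pmf d \<subseteq> {-1, 0, 1}" and p: "\<And>x. pmf d x \<le> p" and J: "J \<le> n + 1" "3 ^ J \<le> q"
  shows "measure_pmf.prob (coeff_law d n) {f. q dvd (\<Sum>j\<le>n. f j * 3 ^ j)} \<le> p ^ J"
proof -
  have fin: "finite (set_pmf d)" using d finite_subset by blast
  have "measure_pmf.prob (coeff_law d n) {f. q dvd (\<Sum>j\<le>n. f j * 3 ^ j)} \<le> p ^ card {..<J}"
  proof (rule prob_coordinates_determined_le[OF fin _ p])
    show "{..<J} \<subseteq> {..n}" using J by auto
    fix f g assume *: "f \<in> {f. q dvd (\<Sum>j\<le>n. f j * 3 ^ j)}" "g \<in> {f. q dvd (\<Sum>j\<le>n. f j * 3 ^ j)}"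
      and s: "f \<in> set_pmf (coeff_law d n)" "g \<in> set_pmf (coeff_law d n)"
      and eq: "\<And>j. j \<notin> {..<J} \<Longrightarrow> f j = g j"
    note c = coeff_law_diff_le[OF d s]
    have "q dvd (\<Sum>j\<le>n. f j * 3 ^ j) - (\<Sum>j\<le>n. g j * 3 ^ j)" using * by (intro dvd_diff) auto
    also have "\<dots> = (\<Sum>j\<le>n. (f j - g j) * 3 ^ j)" by (simp add: sum_subtractf left_diff_distrib)
    also have "\<dots> = (\<Sum>j<J. (f j - g j) * 3 ^ j)"
      using J eq by (intro sum.mono_neutral_right) auto
    finally have "q dvd (\<Sum>j<J. (f j - g j) * 3 ^ j)" .
    moreover have "\<bar>\<Sum>j<J. (f j - g j) * 3 ^ j\<bar> < q"
      using ternary_sum_abs_less[of "\<lambda>j. f j - g j" J] c J(2) by auto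
    ultimately have "(\<Sum>j<J. (f j - g j) * 3 ^ j) = 0" by (metis dvd_imp_le_int abs_ge_self leD order_trans)
    then have "f j - g j = 0" if "j < J" for j by (rule ternary_sum_eq_0[OF c]) (use that in auto)
    then show "f = g" using eq by (intro ext) (metis eq_iff_diff_eq_0 lessThan_iff)
  qed
  then show ?thesis by simp
qed

text \<open>Restricted to the positions L i, the difference of two vanishing sums is a polynomial in
  a^L with coefficients bounded by 2. As |a^L| <= 1/4, these coefficients are all 0.\<close>

lemma prob_small_root_le:
  fixes d :: "int pmf" and a :: complex
  assumes d: "set_pmf d \<subseteq> {-1, 0, 1}" and p: "\<And>x. pmf d x \<le> p" "p \<le> 1"
    and L: "L > 0" "a \<noteq> 0" "norm a ^ L \<le> 1 / 4"
  shows "measure_pmf.prob (coeff_law d n) {f. (\<Sum>j\<le>n. of_int (f j) * a ^ j) = 0} \<le> p ^ (n div L)"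
proof -
  have fin: "finite (set_pmf d)" using d finite_subset by blast
  define I where "I = (\<lambda>i. L * i) ` {..<n div L}"
  have inj: "inj_on (\<lambda>i. L * i) A" for A using L by (auto simp: inj_on_def)
  have "measure_pmf.prob (coeff_law d n) {f. (\<Sum>j\<le>n. of_int (f j) * a ^ j) = 0} \<le> p ^ card I"
  proof (rule prob_coordinates_determined_le[OF fin _ p(1)])
    have "L * i \<le> n" if "i < n div L" for i
      using that by (metis less_imp_le mult_le_mono2 order_trans times_div_less_eq_dividend)
    then show I: "I \<subseteq> {..n}" by (auto simp: I_def)
    fix f g assume *: "f \<in> {f. (\<Sum>j\<le>n. of_int (f j) * a ^ j) = 0}" "g \<in> {f. (\<Sum>j\<le>n. of_int (f j) * a ^ j) = 0}"
      and s: "f \<in> set_pmf (coeff_law d n)" "g \<in> set_pmf (coeff_law d n)"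
      and eq: "\<And>j. j \<notin> I \<Longrightarrow> f j = g j"
    note c = coeff_law_diff_le[OF d s]
    have "0 = (\<Sum>j\<le>n. of_int (f j) * a ^ j) - (\<Sum>j\<le>n. of_int (g j) * a ^ j)" using * by auto
    also have "\<dots> = (\<Sum>j\<le>n. of_int (f j - g j) * a ^ j)" by (simp add: sum_subtractf left_diff_distrib)
    also have "\<dots> = (\<Sum>j\<in>I. of_int (f j - g j) * a ^ j)"
      using I eq by (intro sum.mono_neutral_right) auto
    also have "\<dots> = (\<Sum>i<n div L. of_int (f (L * i) - g (L * i)) * (a ^ L) ^ i)"
      unfolding I_def by (subst sum.reindex[OF inj]) (simp add: power_mult)
    finally have "(\<Sum>i<n div L. of_int (f (L * i) - g (L * i)) * (a ^ L) ^ i) = 0" ..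
    then have "f (L * i) - g (L * i) = 0" if "i < n div L" for i
      using L that c by (intro power_series_int_eq_0[of "\<lambda>i. f (L * i) - g (L * i)" "a ^ L" "n div L"])
        (auto simp: norm_power)
    then have "f j = g j" if "j \<in> I" for j using that by (auto simp: I_def)
    then show "f = g" using eq by blast
  qed
  also have "card I = n div L" unfolding I_def by (simp add: card_image inj)
  finally show ?thesis .
qed

section \<open>Vanishing of integer linear forms\<close>

lemma expectation_prod_coeff_law:
  fixes g :: "nat \<Rightarrow> int \<Rightarrow> complex"
  assumes fin: "finite (set_pmf d)"
  shows "measure_pmf.expectation (coeff_law d n) (\<lambda>f. \<Prod>j\<le>n. g j (f j)) =
    (\<Prod>j\<le>n. measure_pmf.expectation d (g j))"
proof -
  have finc: "finite (set_pmf (coeff_law d n))"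
    unfolding set_coeff_law using fin by (auto intro: finite_PiE_dflt)
  have "prob_space.indep_vars (measure_pmf (coeff_law d n)) (\<lambda>_. count_space UNIV) (\<lambda>j f. f j) {..n}"
    unfolding coeff_law_def by (rule indep_vars_Pi_pmf) auto
  then have ind: "prob_space.indep_vars (measure_pmf (coeff_law d n)) (\<lambda>_. borel) (\<lambda>j f. g j (f j)) {..n}"
    by (rule prob_space.indep_vars_compose2[OF measure_pmf.prob_space_axioms]) auto
  have "measure_pmf.expectation (coeff_law d n) (\<lambda>f. \<Prod>j\<le>n. g j (f j)) =
    (\<Prod>j\<le>n. measure_pmf.expectation (coeff_law d n) (\<lambda>f. g j (f j)))"
    using ind by (intro prob_space.indep_vars_lebesgue_integral[OF measure_pmf.prob_space_axioms]) (auto intro: integrable_measure_pmf_finite[OF finc])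
  also have "\<dots> = (\<Prod>j\<le>n. measure_pmf.expectation d (g j))"
  proof (rule prod.cong)
    fix j assume "j \<in> {..n}"
    then have "map_pmf (\<lambda>f. f j) (coeff_law d n) = d"
      by (simp add: coeff_law_def Pi_pmf_component)
    then show "measure_pmf.expectation (coeff_law d n) (\<lambda>f. g j (f j)) = measure_pmf.expectation d (g j)"
      by (metis integral_map_pmf)
  qed auto
  finally show ?thesis .
qed

text \<open>The bound is in sin^2 t, not in sin^2 (t/2): the atom at 0 may be missing, and then the
  modulus is 1 at every multiple of pi. The constant \<open>\<kappa>\<close> comes from the exact
  formula for the squared modulus together with 1 - cos t >= sin^2 t / 2; it is positive because at
  least two atoms are.\<close>

lemma norm_char_le:
  fixes d :: "int pmf"
  assumes d: "set_pmf d \<subseteq> {-1, 0, 1}" and lt: "\<And>x. pmf d x < 1"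
  obtains \<kappa> :: real where "\<kappa> > 0"
    "\<And>t. norm (measure_pmf.expectation d (\<lambda>x. cis (of_int x * t))) \<le> exp (- \<kappa> * sin t ^ 2)"
proof -
  define a b c where "a = pmf d 0" and "b = pmf d 1" and "c = pmf d (-1)"
  have nn: "a \<ge> 0" "b \<ge> 0" "c \<ge> 0" by (simp_all add: a_def b_def c_def)
  have sum1: "a + b + c = 1"
  proof -
    have "(\<Sum>x\<in>{-1, 0, 1}. pmf d x) = 1" using sum_pmf_eq_1[of "{-1, 0, 1}" d] d by auto
    then show ?thesis by (simp add: a_def b_def c_def)
  qed
  have l1: "a < 1" "b < 1" "c < 1" using lt by (auto simp: a_def b_def c_def)
  define \<kappa> where "\<kappa> = a * (b + c) / 2 + 2 * b * c"
  have k: "\<kappa> > 0"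
  proof (cases "a = 0")
    case True
    then have "b > 0" "c > 0" using sum1 l1 nn by linarith+
    then show ?thesis by (simp add: \<kappa>_def True)
  next
    case False
    then have "a * (b + c) > 0" using sum1 l1 nn by (intro mult_pos_pos) linarith+
    moreover have "b * c \<ge> 0" using nn by simp
    ultimately show ?thesis by (simp add: \<kappa>_def)
  qed
  have "norm (measure_pmf.expectation d (\<lambda>x. cis (of_int x * t))) \<le> exp (- \<kappa> * sin t ^ 2)" for t
  proof -
    have E: "measure_pmf.expectation d (\<lambda>x. cis (of_int x * t)) = a + b * cis t + c * cis (- t)"
      by (subst integral_measure_pmf[of "{-1, 0, 1}"]) (use d in \<open>auto simp: a_def b_def c_def scaleR_conv_of_real\<close>)
    have sc: "sin t ^ 2 = 1 - cos t ^ 2" by (simp add: sin_squared_eq)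
    have "norm (a + b * cis t + c * cis (- t)) ^ 2 = (a + (b + c) * cos t) ^ 2 + ((b - c) * sin t) ^ 2"
      by (simp add: cmod_power2 algebra_simps)
    also have "\<dots> = (a + b + c)\<^sup>2 - 2 * (a * (b + c)) * (1 - cos t) - 4 * b * c * sin t ^ 2"
      unfolding power_mult_distrib sc by (simp add: power2_eq_square algebra_simps)
    also have "\<dots> \<le> 1 - 2 * \<kappa> * sin t ^ 2"
    proof -
      have "sin t ^ 2 = (1 - cos t) * (1 + cos t)" unfolding sc by (simp add: power2_eq_square algebra_simps)
      also have "\<dots> \<le> (1 - cos t) * 2" by (intro mult_left_mono) auto
      finally have "a * (b + c) * (sin t ^ 2) \<le> a * (b + c) * ((1 - cos t) * 2)"
        using nn by (intro mult_left_mono) auto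
      moreover have "2 * \<kappa> * sin t ^ 2 = a * (b + c) * (sin t ^ 2) + 4 * b * c * sin t ^ 2"
        by (simp add: \<kappa>_def field_simps)
      moreover have "2 * (a * (b + c)) * (1 - cos t) = a * (b + c) * ((1 - cos t) * 2)" by simp
      moreover have "(a + b + c)\<^sup>2 = 1" by (simp only: sum1) simp
      ultimately show ?thesis by linarith
    qed
    also have "\<dots> \<le> exp (- 2 * \<kappa> * sin t ^ 2)" using exp_ge_add_one_self[of "- 2 * \<kappa> * sin t ^ 2"] by simp
    also have "\<dots> = exp (- \<kappa> * sin t ^ 2) ^ 2" by (simp flip: exp_of_nat_mult)
    finally show ?thesis unfolding E by (rule power2_le_imp_le) auto
  qed
  then show ?thesis using that k by blast
qed

text \<open>\<open>V\<close> is the indicator of \<open>q\<close> dividing \<open>X\<close>, as a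
  geometric sum over a \<open>q\<close>-th root of unity.\<close>

lemma cis_average:
  fixes X :: int and q :: nat
  assumes "q > 0"
  defines "V \<equiv> (\<Sum>h<q. cis (2 * pi * real h * of_int X / real q)) / of_nat q"
  shows "V = 0 \<or> V = 1" "X = 0 \<Longrightarrow> V = 1"
proof -
  define z where "z = cis (2 * pi * of_int X / real q)"
  have "(\<Sum>h<q. cis (2 * pi * real h * of_int X / real q)) = (\<Sum>h<q. z ^ h)"
    by (intro sum.cong) (auto simp: z_def Complex.DeMoivre mult_ac)
  then have V: "V = (\<Sum>h<q. z ^ h) / of_nat q" by (simp add: V_def)
  have "z ^ q = cis (2 * pi * of_int X)" using assms(1) by (simp add: z_def Complex.DeMoivre)
  also have "\<dots> = 1" by (rule cis_multiple_2pi) auto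
  finally have zq: "z ^ q = 1" .
  show "V = 0 \<or> V = 1"
  proof (cases "z = 1")
    case True
    then show ?thesis using assms(1) by (simp add: V)
  next
    case False
    then have "(\<Sum>h<q. z ^ h) = 0" using zq by (subst sum_gp_strict) auto
    then show ?thesis by (simp add: V)
  qed
  show "V = 1" if "X = 0" using assms(1) that by (simp add: V z_def)
qed

lemma prod_cis: "(\<Prod>i\<in>I. cis (f i)) = cis (\<Sum>i\<in>I. f i)"
  by (induction I rule: infinite_finite_induct) (auto simp: cis_mult)

text \<open>Vanishing of the i-th form is relaxed to divisibility by \<open>q i\<close>, whose
  indicator is an average of characters. Of the frequency vectors \<open>h\<close>, the zero vector
  yields the main term, and every other one is at most exp(-\<kappa> R) by independence. Each form
  may have its own modulus.\<close>

lemma prob_linear_forms_vanish_le: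
  fixes d :: "int pmf" and L :: "'i \<Rightarrow> nat \<Rightarrow> int" and q :: "'i \<Rightarrow> nat"
  assumes d: "set_pmf d \<subseteq> {-1, 0, 1}"
    and char: "\<And>t. norm (measure_pmf.expectation d (\<lambda>x. cis (of_int x * t))) \<le> exp (- \<kappa> * sin t ^ 2)"
    and \<kappa>: "\<kappa> > 0" and I: "finite I" and q: "\<And>i. i \<in> I \<Longrightarrow> q i > 0"
    and R: "\<And>h. h \<in> PiE I (\<lambda>i. {..<q i}) \<Longrightarrow> (\<exists>i\<in>I. h i \<noteq> 0) \<Longrightarrow>
       R \<le> (\<Sum>j\<le>n. sin (2 * pi * (\<Sum>i\<in>I. real (h i) * of_int (L i j) / real (q i))) ^ 2)"
  shows "measure_pmf.prob (coeff_law d n) {f. \<forall>i\<in>I. (\<Sum>j\<le>n. f j * L i j) = 0}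
     \<le> 1 / (\<Prod>i\<in>I. real (q i)) + exp (- \<kappa> * R)"
proof -
  define H where "H = PiE I (\<lambda>i. {..<q i})"
  define Q where "Q = (\<Prod>i\<in>I. real (q i))"
  define X where "X f i = (\<Sum>j\<le>n. f j * L i j)" for f :: "nat \<Rightarrow> int" and i
  define \<theta> where "\<theta> h j = 2 * pi * (\<Sum>i\<in>I. real (h i) * of_int (L i j) / real (q i))" for h :: "'i \<Rightarrow> nat" and j
  define E where "E = {f. \<forall>i\<in>I. X f i = 0}"
  define W where "W f = (\<Prod>i\<in>I. (\<Sum>h<q i. cis (2 * pi * real h * of_int (X f i) / real (q i))) / of_nat (q i))" for f
  define \<phi> where "\<phi> t = measure_pmf.expectation d (\<lambda>x. cis (of_int x * t))" for t :: real
  have fin: "finite (set_pmf d)" using d finite_subset by blast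
  have finc: "finite (set_pmf (coeff_law d n))"
    unfolding set_coeff_law using fin by (auto intro: finite_PiE_dflt)
  note int = integrable_measure_pmf_finite[OF finc]
  have finH: "finite H" unfolding H_def by (intro finite_PiE I) auto
  have Qpos: "Q > 0" unfolding Q_def using q by (intro prod_pos) auto
  have cardH: "real (card H) = Q" unfolding H_def Q_def by (simp add: card_PiE I)
  \<comment> \<open>Regrouping the phases by coefficient instead of by form makes every summand a
    product of functions of single coefficients, to which independence applies.\<close>
  have W: "W f = (\<Sum>h\<in>H. \<Prod>j\<le>n. cis (of_int (f j) * \<theta> h j)) / of_real Q" for f
  proof -
    have "W f = (\<Prod>i\<in>I. \<Sum>h<q i. cis (2 * pi * real h * of_int (X f i) / real (q i))) / of_real Q"
      by (simp add: W_def prod_dividef Q_def)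
    also have "(\<Prod>i\<in>I. \<Sum>h<q i. cis (2 * pi * real h * of_int (X f i) / real (q i))) =
      (\<Sum>h\<in>H. \<Prod>i\<in>I. cis (2 * pi * real (h i) * of_int (X f i) / real (q i)))"
      unfolding H_def by (rule prod_sum_PiE) (auto simp: I)
    also have "\<dots> = (\<Sum>h\<in>H. \<Prod>j\<le>n. cis (of_int (f j) * \<theta> h j))"
    proof (rule sum.cong[OF refl])
      fix h
      have "(\<Sum>i\<in>I. 2 * pi * real (h i) * of_int (X f i) / real (q i)) =
        (\<Sum>i\<in>I. \<Sum>j\<le>n. of_int (f j) * (2 * pi * (real (h i) * of_int (L i j) / real (q i))))"
        by (simp add: X_def sum_distrib_left sum_divide_distrib mult_ac)
      also have "\<dots> = (\<Sum>j\<le>n. of_int (f j) * \<theta> h j)"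
        unfolding \<theta>_def by (subst sum.swap) (simp add: sum_distrib_left)
      finally show "(\<Prod>i\<in>I. cis (2 * pi * real (h i) * of_int (X f i) / real (q i))) =
        (\<Prod>j\<le>n. cis (of_int (f j) * \<theta> h j))" by (simp add: prod_cis)
    qed
    finally show ?thesis .
  qed
  \<comment> \<open>Only an inequality: \<open>W f\<close> is also 1 if all forms are multiples,
    possibly nonzero, of their moduli.\<close>
  have ind: "indicator E f \<le> Re (W f)" for f
  proof (cases "f \<in> E")
    case True
    then have "W f = 1" unfolding W_def using cis_average(2) q by (intro prod.neutral) (auto simp: E_def)
    then show ?thesis by (simp add: indicator_def)
  next
    case False
    define V where "V i = (\<Sum>h<q i. cis (2 * pi * real h * of_int (X f i) / real (q i))) / of_nat (q i)" for i
    have V: "V i = 0 \<or> V i = 1" if "i \<in> I" for i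
      unfolding V_def by (rule cis_average(1)[OF q[OF that]])
    have WV: "W f = (\<Prod>i\<in>I. V i)" by (simp add: W_def V_def)
    have "W f = 0 \<or> W f = 1"
    proof (cases "\<exists>i\<in>I. V i = 0")
      case True
      then have "(\<Prod>i\<in>I. V i) = 0" by (rule prod_zero[OF I])
      then show ?thesis by (simp add: WV)
    next
      case False
      then have "(\<Prod>i\<in>I. V i) = 1" using V by (intro prod.neutral) auto
      then show ?thesis by (simp add: WV)
    qed
    then show ?thesis using False by auto
  qed
  have EW: "measure_pmf.expectation (coeff_law d n) W = (\<Sum>h\<in>H. \<Prod>j\<le>n. \<phi> (\<theta> h j)) / of_real Q"
  proof -
    have "measure_pmf.expectation (coeff_law d n) W = measure_pmf.expectation (coeff_law d n)
        (\<lambda>f. (\<Sum>h\<in>H. \<Prod>j\<le>n. cis (of_int (f j) * \<theta> h j)) / of_real Q)"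
      by (rule Bochner_Integration.integral_cong[OF refl W])
    also have "\<dots> = measure_pmf.expectation (coeff_law d n)
        (\<lambda>f. \<Sum>h\<in>H. \<Prod>j\<le>n. cis (of_int (f j) * \<theta> h j)) / of_real Q"
      by (rule integral_divide_zero)
    also have "measure_pmf.expectation (coeff_law d n) (\<lambda>f. \<Sum>h\<in>H. \<Prod>j\<le>n. cis (of_int (f j) * \<theta> h j)) =
        (\<Sum>h\<in>H. measure_pmf.expectation (coeff_law d n) (\<lambda>f. \<Prod>j\<le>n. cis (of_int (f j) * \<theta> h j)))"
      by (rule Bochner_Integration.integral_sum) (rule int)
    also have "\<dots> = (\<Sum>h\<in>H. \<Prod>j\<le>n. \<phi> (\<theta> h j))"
      unfolding \<phi>_def
      by (intro sum.cong refl expectation_prod_coeff_law[OF fin, of n "\<lambda>j x. cis (of_int x * \<theta> _ j)"])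
    finally show ?thesis .
  qed
  have "measure_pmf.prob (coeff_law d n) E = measure_pmf.expectation (coeff_law d n) (indicator E)"
    by simp
  also have "\<dots> \<le> measure_pmf.expectation (coeff_law d n) (\<lambda>f. Re (W f))"
    by (intro integral_mono int ind)
  also have "\<dots> = Re (measure_pmf.expectation (coeff_law d n) W)"
    by (rule integral_Re) (rule int)
  also have "\<dots> \<le> norm (measure_pmf.expectation (coeff_law d n) W)" by (rule complex_Re_le_cmod)
  also have "\<dots> = norm (\<Sum>h\<in>H. \<Prod>j\<le>n. \<phi> (\<theta> h j)) / Q"
    unfolding EW using Qpos by (simp add: norm_divide)
  \<comment> \<open>The zero frequency is bounded by 1 and the others by the exponential; adding the
    exponential everywhere keeps the summand uniform, and division by \<open>Q\<close> cancels their
    number.\<close>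
  also have "norm (\<Sum>h\<in>H. \<Prod>j\<le>n. \<phi> (\<theta> h j)) \<le> (\<Sum>h\<in>H. of_bool (\<forall>i\<in>I. h i = 0) + exp (- \<kappa> * R))"
  proof (rule sum_norm_le)
    fix h assume h: "h \<in> H"
    have "norm (\<Prod>j\<le>n. \<phi> (\<theta> h j)) = (\<Prod>j\<le>n. norm (\<phi> (\<theta> h j)))" by (simp add: prod_norm)
    also have "\<dots> \<le> (\<Prod>j\<le>n. exp (- \<kappa> * sin (\<theta> h j) ^ 2))"
      using char by (intro prod_mono) (auto simp: \<phi>_def)
    also have "\<dots> = exp (- \<kappa> * (\<Sum>j\<le>n. sin (\<theta> h j) ^ 2))"
      by (simp add: exp_sum sum_distrib_left flip: sum_negf)
    finally have *: "norm (\<Prod>j\<le>n. \<phi> (\<theta> h j)) \<le> exp (- \<kappa> * (\<Sum>j\<le>n. sin (\<theta> h j) ^ 2))" .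
    show "norm (\<Prod>j\<le>n. \<phi> (\<theta> h j)) \<le> of_bool (\<forall>i\<in>I. h i = 0) + exp (- \<kappa> * R)"
    proof (cases "\<forall>i\<in>I. h i = 0")
      case True
      have "- \<kappa> * (\<Sum>j\<le>n. sin (\<theta> h j) ^ 2) \<le> 0"
        using \<kappa> by (simp add: sum_nonneg)
      then have "exp (- \<kappa> * (\<Sum>j\<le>n. sin (\<theta> h j) ^ 2)) \<le> 1" by (simp only: exp_le_one_iff)
      moreover have "exp (- \<kappa> * R) \<ge> 0" by simp
      ultimately have "norm (\<Prod>j\<le>n. \<phi> (\<theta> h j)) \<le> 1 + exp (- \<kappa> * R)" using * by linarith
      then show ?thesis using True by simp
    next
      case False
      then have "R \<le> (\<Sum>j\<le>n. sin (\<theta> h j) ^ 2)" using R[of h] h by (auto simp: H_def \<theta>_def)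
      then have "exp (- \<kappa> * (\<Sum>j\<le>n. sin (\<theta> h j) ^ 2)) \<le> exp (- \<kappa> * R)" using \<kappa> by simp
      then have "norm (\<Prod>j\<le>n. \<phi> (\<theta> h j)) \<le> exp (- \<kappa> * R)" by (rule order_trans[OF *])
      then show ?thesis using False by auto
    qed
  qed
  also have "(\<Sum>h\<in>H. of_bool (\<forall>i\<in>I. h i = 0) + exp (- \<kappa> * R)) = (\<Sum>h\<in>H. of_bool (\<forall>i\<in>I. h i = 0)) + Q * exp (- \<kappa> * R)"
    by (simp add: sum.distrib cardH)
  also have "(\<Sum>h\<in>H. of_bool (\<forall>i\<in>I. h i = 0) :: real) \<le> 1"
  proof -
    have "H \<inter> {h. \<forall>i\<in>I. h i = 0} \<subseteq> {restrict (\<lambda>_. 0) I}"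
      by (auto simp: H_def PiE_def extensional_def restrict_def fun_eq_iff)
    then have "card (H \<inter> {h. \<forall>i\<in>I. h i = 0}) \<le> card {restrict (\<lambda>_. 0 :: nat) I}"
      by (intro card_mono) auto
    then have "card (H \<inter> {h. \<forall>i\<in>I. h i = 0}) \<le> 1" by simp
    then show ?thesis using finH by simp
  qed
  finally have "measure_pmf.prob (coeff_law d n) E \<le> (1 + Q * exp (- \<kappa> * R)) / Q"
    using Qpos by (simp add: divide_right_mono)
  also have "\<dots> = 1 / Q + exp (- \<kappa> * R)" using Qpos by (simp add: field_simps)
  finally show ?thesis by (simp add: E_def X_def Q_def)
qed

section \<open>Counting integer polynomials by their Newton sums\<close>

text \<open>The logarithmic derivative of the product of the factors 1 - b_i X, multiplied by -X, is the generating function of the power sums.\<close>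

lemma newton_fps:
  fixes b :: "nat \<Rightarrow> complex"
  defines "S \<equiv> (\<lambda>k. Abs_fps (\<lambda>t. if t = 0 then 0 else \<Sum>i<k. b i ^ t))"
  shows "fps_X * fps_deriv (\<Prod>i<k. 1 - fps_const (b i) * fps_X) =
    - ((\<Prod>i<k. 1 - fps_const (b i) * fps_X) * S k)"
proof (induction k)
  case 0
  have "S 0 = 0" by (simp add: S_def fps_eq_iff)
  then show ?case by simp
next
  case (Suc k)
  define F where "F = (\<Prod>i<k. 1 - fps_const (b i) * fps_X)"
  define T where "T = Abs_fps (\<lambda>t. if t = 0 then 0 else b k ^ t)"
  have S: "S (Suc k) = S k + T" by (simp add: S_def T_def fps_eq_iff)
  have T: "(1 - fps_const (b k) * fps_X) * T = fps_const (b k) * fps_X"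
  proof (rule fps_ext)
    fix t
    show "fps_nth ((1 - fps_const (b k) * fps_X) * T) t = fps_nth (fps_const (b k) * fps_X) t"
      by (cases t) (auto simp: T_def left_diff_distrib mult.assoc fps_mult_left_const_nth power_eq_if)
  qed
  have "fps_X * fps_deriv (F * (1 - fps_const (b k) * fps_X)) =
    (1 - fps_const (b k) * fps_X) * (fps_X * fps_deriv F) - F * (fps_const (b k) * fps_X)"
    by (simp add: algebra_simps)
  also have "\<dots> = (1 - fps_const (b k) * fps_X) * (- (F * S k)) - F * ((1 - fps_const (b k) * fps_X) * T)"
    using Suc by (simp only: F_def T)
  also have "\<dots> = - (F * (1 - fps_const (b k) * fps_X) * (S k + T))"
    by (simp add: ring_distribs mult_ac)
  finally show ?case by (simp add: F_def S)
qed

text \<open>\<open>\<sigma> t\<close> is the power sum of the inverse roots, which have modulus at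
  most \<open>r\<close>. Newton's identities come from comparing coefficients in the logarithmic
  derivative; as \<open>coeff m 0\<close> is 1 or -1, they can be solved for the power sums over the
  integers, which gives integrality by induction.\<close>

lemma newton_sums:
  fixes m :: "int poly" and r :: real
  assumes m0: "\<bar>coeff m 0\<bar> = 1" and r: "r > 0"
    and roots: "\<And>z. poly (cpoly m) z = 0 \<Longrightarrow> 1 / r \<le> norm z"
  obtains \<sigma> :: "nat \<Rightarrow> int" where
    "\<And>t. of_nat t * coeff m t = - (\<Sum>i<t. \<sigma> (t - i) * coeff m i)"
    "\<And>t. t > 0 \<Longrightarrow> \<bar>\<sigma> t\<bar> \<le> degree m * r ^ t"
proof -
  define k where "k = degree m"
  obtain z where z: "smult (lead_coeff (cpoly m)) (\<Prod>i<degree (cpoly m). [:- z i, 1:]) = cpoly m"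
    using complex_poly_decompose' by blast
  define C where "C = lead_coeff (cpoly m)"
  have dec: "cpoly m = smult C (\<Prod>i<k. [:- z i, 1:])" using z by (simp add: C_def k_def)
  have rt: "poly (cpoly m) (z i) = 0" if "i < k" for i
    using that by (auto simp: dec poly_prod intro!: prod_zero)
  have z0: "z i \<noteq> 0" if "i < k" for i
    using roots[OF rt[OF that]] r by auto
  define b where "b i = inverse (z i)" for i
  have nb: "norm (b i) \<le> r" if "i < k" for i
    using roots[OF rt[OF that]] r z0[OF that] by (simp add: b_def norm_divide divide_simps mult.commute)
  define s where "s t = (\<Sum>i<k. b i ^ t)" for t
  define F where "F = (\<Prod>i<k. 1 - fps_const (b i) * fps_X)"
  define D where "D = C * (\<Prod>i<k. - z i)"
  have fm: "fps_of_poly (cpoly m) = fps_const D * F"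
  proof -
    have "[:- z i, 1:] = smult (- z i) [:1, - b i:]" if "i < k" for i
      using z0[OF that] by (simp add: b_def)
    then have "(\<Prod>i<k. [:- z i, 1:]) = (\<Prod>i<k. smult (- z i) [:1, - b i:])" by (intro prod.cong) auto
    also have "\<dots> = smult (\<Prod>i<k. - z i) (\<Prod>i<k. [:1, - b i:])" by (rule prod_smult)
    finally have "cpoly m = smult D (\<Prod>i<k. [:1, - b i:])" by (simp add: dec D_def)
    moreover have "fps_of_poly [:1, - b i:] = 1 - fps_const (b i) * fps_X" for i
      by (simp add: fps_of_poly_pCons fps_of_poly_linear algebra_simps flip: fps_const_neg)
    ultimately show ?thesis by (simp only: fps_of_poly_smult fps_of_poly_prod F_def)
  qed
  define S where "S = Abs_fps (\<lambda>t. if t = 0 then 0 else s t)"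
  have S_nth: "fps_nth S t = (if t = 0 then 0 else s t)" for t by (simp add: S_def)
  have "fps_X * fps_deriv F = - (F * S)"
    using newton_fps[of b k] by (simp only: F_def S_def s_def)
  then have "fps_const D * (fps_X * fps_deriv F) = fps_const D * - (F * S)" by (simp only:)
  then have "fps_X * fps_deriv (fps_of_poly (cpoly m)) = - (fps_of_poly (cpoly m) * S)"
    by (simp add: fm mult_ac)
  then have N': "fps_nth (fps_X * fps_deriv (fps_of_poly (cpoly m))) t = fps_nth (- (fps_of_poly (cpoly m) * S)) t" for t
    by (simp only:)
  have N0: "of_nat t * of_int (coeff m t) = - (\<Sum>i\<le>t. of_int (coeff m i) * fps_nth S (t - i))" for t
  proof -
    have "fps_nth (fps_X * fps_deriv (fps_of_poly (cpoly m))) t = of_nat t * of_int (coeff m t)"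
      by (cases t) simp_all
    moreover have "fps_nth (fps_of_poly (cpoly m) * S) t = (\<Sum>i\<le>t. of_int (coeff m i) * fps_nth S (t - i))"
      by (simp add: fps_mult_nth atMost_atLeast0)
    ultimately show ?thesis using N'[of t] by simp
  qed
  have N: "of_nat t * of_int (coeff m t) = - (\<Sum>i<t. s (t - i) * of_int (coeff m i))" for t
  proof -
    have "(\<Sum>i\<le>t. of_int (coeff m i) * fps_nth S (t - i)) = (\<Sum>i<t. of_int (coeff m i) * fps_nth S (t - i))"
      by (simp add: S_nth flip: lessThan_Suc_atMost)
    also have "\<dots> = (\<Sum>i<t. s (t - i) * of_int (coeff m i))"
      by (intro sum.cong) (auto simp: S_nth)
    finally show ?thesis using N0[of t] by simp
  qed
  have int: "s t \<in> \<int>" if "t > 0" for t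
    using that
  proof (induction t rule: less_induct)
    case (less t)
    then obtain u where u: "t = Suc u" using gr0_conv_Suc by auto
    have "s t * of_int (coeff m 0) = - of_nat t * of_int (coeff m t)
        - (\<Sum>i<u. s (t - Suc i) * of_int (coeff m (Suc i)))"
    proof -
      have "of_nat t * of_int (coeff m t) = - (s t * of_int (coeff m 0)
        + (\<Sum>i<u. s (t - Suc i) * of_int (coeff m (Suc i))))"
        using N[of t] unfolding u sum.lessThan_Suc_shift by simp
      then show ?thesis by simp
    qed
    also have "\<dots> \<in> \<int>" using less u by (intro Ints_diff Ints_mult Ints_sum Ints_minus) auto
    finally have "s t * of_int (coeff m 0) * of_int (coeff m 0) \<in> \<int>" by (rule Ints_mult) auto
    moreover have "coeff m 0 = 1 \<or> coeff m 0 = - 1" using m0 by auto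
    ultimately show ?case by auto
  qed
  define \<sigma> where "\<sigma> t = \<lfloor>Re (s t)\<rfloor>" for t
  have \<sigma>: "s t = of_int (\<sigma> t)" if "t > 0" for t
    using int[OF that] by (auto simp: \<sigma>_def elim: Ints_cases)
  have 1: "of_nat t * coeff m t = - (\<Sum>i<t. \<sigma> (t - i) * coeff m i)" for t
  proof -
    have "(of_int (of_nat t * coeff m t) :: complex) = of_int (- (\<Sum>i<t. \<sigma> (t - i) * coeff m i))"
      using N[of t] \<sigma> by simp
    then show ?thesis by (simp only: of_int_eq_iff)
  qed
  have 2: "\<bar>\<sigma> t\<bar> \<le> degree m * r ^ t" if "t > 0" for t
  proof -
    have "norm (s t) \<le> (\<Sum>i<k. r ^ t)"
      unfolding s_def by (intro sum_norm_le) (simp add: norm_power power_mono nb)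
    then show ?thesis using \<sigma>[OF that] by (simp add: k_def)
  qed
  show ?thesis using that 1 2 by blast
qed

text \<open>Newton's identities also determine \<open>coeff m t\<close> from earlier coefficients
  and power sums, after division by t. So \<open>m\<close> is encoded by the sign
  \<open>coeff m 0\<close> and \<open>k\<close> integers in [-N, N].\<close>

lemma card_unit_polys_le:
  fixes k N :: nat and r :: real
  assumes r: "r \<ge> 1" and N: "k * r ^ k \<le> N"
  defines "M \<equiv> {m :: int poly. degree m = k \<and> \<bar>coeff m 0\<bar> = 1 \<and>
    (\<forall>z. poly (cpoly m) z = 0 \<longrightarrow> 1 / r \<le> norm z)}"
  shows "finite M" "card M \<le> 2 * (2 * N + 1) ^ k"
proof -
  define P where "P m \<sigma> \<longleftrightarrow> (\<forall>t. of_nat t * coeff m t = - (\<Sum>i<t. \<sigma> (t - i) * coeff m i)) \<and>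
    (\<forall>t>0. \<bar>\<sigma> t\<bar> \<le> degree m * r ^ t)" for m :: "int poly" and \<sigma> :: "nat \<Rightarrow> int"
  have "\<exists>\<sigma>. P m \<sigma>" if "m \<in> M" for m
    using newton_sums[of m r] that r unfolding M_def P_def by (smt (verit, best) mem_Collect_eq)
  then obtain \<sigma> where \<sigma>: "\<And>m. m \<in> M \<Longrightarrow> P m (\<sigma> m)" by metis
  define F where "F m = (coeff m 0, restrict (\<sigma> m) {1..k})" for m
  define T where "T = {-1, 1 :: int} \<times> PiE {1..k} (\<lambda>_. {- int N..int N})"
  have FT: "F ` M \<subseteq> T"
  proof
    fix x assume "x \<in> F ` M"
    then obtain m where m: "m \<in> M" "x = F m" by blast
    have "- int N \<le> \<sigma> m t \<and> \<sigma> m t \<le> int N" if "t \<in> {1..k}" for t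
    proof -
      have "real_of_int \<bar>\<sigma> m t\<bar> \<le> k * r ^ t" using \<sigma>[OF m(1)] m(1) that by (auto simp: P_def M_def)
      also have "\<dots> \<le> k * r ^ k" using that r by (intro mult_left_mono power_increasing) auto
      finally show ?thesis using N by linarith
    qed
    moreover have "coeff m 0 \<in> {-1, 1}" using m(1) by (auto simp: M_def)
    ultimately show "x \<in> T" unfolding m(2) F_def T_def by auto
  qed
  have inj: "inj_on F M"
  proof (rule inj_onI)
    fix m m' assume m: "m \<in> M" "m' \<in> M" "F m = F m'"
    have c0: "coeff m 0 = coeff m' 0" using m(3) by (simp add: F_def)
    have eq: "\<sigma> m t = \<sigma> m' t" if "t \<in> {1..k}" for t
    proof -
      have "restrict (\<sigma> m) {1..k} t = restrict (\<sigma> m') {1..k} t" using m(3) by (simp add: F_def)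
      then show ?thesis using that by simp
    qed
    have "t \<le> k \<Longrightarrow> coeff m t = coeff m' t" for t
    proof (induction t rule: less_induct)
      case (less t)
      show ?case
      proof (cases "t = 0")
        case False
        have "(\<Sum>i<t. \<sigma> m (t - i) * coeff m i) = (\<Sum>i<t. \<sigma> m' (t - i) * coeff m' i)"
        proof (rule sum.cong[OF refl])
          fix i assume "i \<in> {..<t}"
          then have "t - i \<in> {1..k}" "coeff m i = coeff m' i" using less by auto
          then show "\<sigma> m (t - i) * coeff m i = \<sigma> m' (t - i) * coeff m' i" using eq[of "t - i"] by (simp only:)
        qed
        then have "of_nat t * coeff m t = of_nat t * coeff m' t"
          using \<sigma>[OF m(1)] \<sigma>[OF m(2)] by (simp add: P_def)
        then show ?thesis using False by simp
      qed (use c0 in simp)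
    qed
    then show "m = m'" using m(1,2) by (intro poly_eqI) (metis (mono_tags, lifting) M_def coeff_eq_0 linorder_not_le mem_Collect_eq)
  qed
  have finT: "finite T" unfolding T_def by (intro finite_cartesian_product finite_PiE) auto
  show "finite M" using finT FT inj by (metis finite_imageD finite_subset)
  have "card M \<le> card T" by (rule card_inj_on_le[OF inj FT finT])
  also have "card T = 2 * (2 * N + 1) ^ k"
    by (simp add: T_def card_cartesian_product card_PiE nat_add_distrib nat_mult_distrib)
  finally show "card M \<le> 2 * (2 * N + 1) ^ k" .
qed

section \<open>Divisibility and linear recurrences\<close>

text \<open>The dual of division by \<open>g\<close>: for monic \<open>g\<close>, sending x^j to the
  j-th term kills the multiples of \<open>g\<close>, and with the i-th unit vector as initial values
  it reads off the i-th coefficient of the remainder modulo \<open>g\<close>.\<close>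

function lin_rec_seq :: "int poly \<Rightarrow> (nat \<Rightarrow> int) \<Rightarrow> nat \<Rightarrow> int" where
  "lin_rec_seq g h j = (if j < degree g then h j
     else - (\<Sum>i<degree g. coeff g i * lin_rec_seq g h (j - degree g + i)))"
  by auto
termination by (relation "Wellfounded.measure (\<lambda>(g, h, j). j)") auto

declare lin_rec_seq.simps [simp del]

lemma lin_rec_seq_init: "j < degree g \<Longrightarrow> lin_rec_seq g h j = h j"
  by (simp add: lin_rec_seq.simps)

lemma lin_rec_seq_rec:
  assumes "lead_coeff g = 1"
  shows "(\<Sum>i\<le>degree g. coeff g i * lin_rec_seq g h (t + i)) = 0"
  unfolding lessThan_Suc_atMost[symmetric] sum.lessThan_Suc
  using assms by (simp add: lin_rec_seq.simps[of g h "t + degree g"])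

definition lin_functional :: "(nat \<Rightarrow> int) \<Rightarrow> int poly \<Rightarrow> int" where
  "lin_functional a p = (\<Sum>j\<le>degree p. coeff p j * a j)"

lemma lin_functional_eq: "degree p \<le> n \<Longrightarrow> lin_functional a p = (\<Sum>j\<le>n. coeff p j * a j)"
  unfolding lin_functional_def by (intro sum.mono_neutral_left) (auto simp: coeff_eq_0)

lemma lin_functional_add: "lin_functional a (p + q) = lin_functional a p + lin_functional a q"
proof -
  define N where "N = max (degree p) (degree q)"
  have "degree (p + q) \<le> N" unfolding N_def by (rule degree_add_le_max)
  then show ?thesis
    using lin_functional_eq[of "p + q" N] lin_functional_eq[of p N] lin_functional_eq[of q N]
    by (simp add: N_def sum.distrib algebra_simps)
qed

lemma lin_functional_smult: "lin_functional a (smult c p) = c * lin_functional a p"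
  using lin_functional_eq[OF degree_smult_le] by (simp add: lin_functional_def sum_distrib_left mult_ac)

lemma lin_functional_pCons_0: "lin_functional a (pCons 0 p) = lin_functional (\<lambda>j. a (Suc j)) p"
  by (subst lin_functional_eq[of _ "Suc (degree p)"])
     (simp_all add: degree_pCons_le sum.atMost_Suc_shift lin_functional_def del: sum.atMost_Suc)

text \<open>Multiplication by x shifts the sequence, and the recurrence is invariant under shifts;
  hence the induction on \<open>q\<close> with \<open>a\<close> arbitrary.\<close>

lemma lin_functional_mult_eq_0:
  assumes "\<And>t. (\<Sum>i\<le>degree g. coeff g i * a (t + i)) = 0"
  shows "lin_functional a (g * q) = 0"
  using assms
proof (induction q arbitrary: a)
  case (pCons c q)
  have "lin_functional a (g * pCons c q) = c * lin_functional a g + lin_functional (\<lambda>j. a (Suc j)) (g * q)"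
    by (simp add: mult_pCons_right lin_functional_add lin_functional_smult lin_functional_pCons_0)
  also have "lin_functional (\<lambda>j. a (Suc j)) (g * q) = 0"
    by (rule pCons.IH) (use pCons.prems[of "Suc _"] in simp)
  finally show ?case using pCons.prems[of 0] by (simp add: lin_functional_def)
qed (simp add: lin_functional_def)

lemma lin_rec_seq_annihilates:
  assumes g: "lead_coeff g = 1" "g dvd p" and n: "degree p \<le> n"
  shows "(\<Sum>j\<le>n. coeff p j * lin_rec_seq g h j) = 0"
proof -
  obtain q where "p = g * q" using g(2) by (elim dvdE)
  then show ?thesis
    using lin_functional_mult_eq_0[of g "lin_rec_seq g h" q] lin_rec_seq_rec[OF g(1)] lin_functional_eq[OF n] by simp
qed

lemma degree_int_rand_poly: "degree (int_rand_poly n f) \<le> n"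
  by (intro degree_le) (simp add: coeff_int_rand_poly)

text \<open>Let w = cis (2 \<theta>). Since the powers of w sum to 0 and |1 - w^k| \<le> k |1 - w|, summing 1 - w^k over k < A gives A \<le> |1 - w| A^2 / 2, and |1 - w| = 2 |sin \<theta>|.\<close>

lemma sin_squared_ge_of_root_of_unity:
  assumes "cis (2 * \<theta>) ^ A = 1" "cis (2 * \<theta>) \<noteq> 1" "A > 0"
  shows "sin \<theta> ^ 2 \<ge> 1 / real A ^ 2"
proof -
  define w where "w = cis (2 * \<theta>)"
  have nw: "norm (1 - w ^ k) \<le> real k * norm (1 - w)" for k
  proof (induction k)
    case (Suc k)
    have "1 - w ^ Suc k = (1 - w ^ k) + w ^ k * (1 - w)" by (simp add: algebra_simps)
    also have "norm \<dots> \<le> norm (1 - w ^ k) + norm (1 - w)"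
      using norm_triangle_ineq[of "1 - w ^ k" "w ^ k * (1 - w)"] by (simp add: norm_mult norm_power w_def)
    finally show ?case using Suc by (simp add: algebra_simps)
  qed simp
  have "(\<Sum>k<A. w ^ k) = 0" using assms by (subst sum_gp_strict) (auto simp: w_def)
  then have "of_nat A = (\<Sum>k<A. 1 - w ^ k)" by (simp add: sum_subtractf)
  then have "real A = norm (\<Sum>k<A. 1 - w ^ k)" by (metis norm_of_nat)
  also have "\<dots> \<le> (\<Sum>k<A. real k * norm (1 - w))" by (intro sum_norm_le nw)
  also have "\<dots> = (\<Sum>k<A. real k) * norm (1 - w)" by (simp add: sum_distrib_right)
  also have "(\<Sum>k<A. real k) \<le> real A ^ 2 / 2"
    by (induction A) (auto simp: power2_eq_square field_simps)
  finally have "real A \<le> real A ^ 2 / 2 * norm (1 - w)" by (simp add: mult_right_mono)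
  then have "1 / real A \<le> norm (1 - w) / 2" using assms(3) by (simp add: field_simps power2_eq_square)
  then have "(1 / real A) ^ 2 \<le> (norm (1 - w) / 2) ^ 2" by (intro power_mono) auto
  also have "\<dots> = ((1 - cos (2 * \<theta>)) ^ 2 + sin (2 * \<theta>) ^ 2) / 4"
    by (simp add: power_divide cmod_power2 w_def)
  also have "\<dots> = (1 - cos (2 * \<theta>)) / 2"
    using sin_cos_squared_add[of "2 * \<theta>"] by (simp add: power2_eq_square field_simps)
  also have "\<dots> = sin \<theta> ^ 2" by (simp add: cos_double_sin)
  finally show ?thesis by (simp add: power_divide)
qed

lemma cis_int_frac:
  assumes "A > 0"
  shows "cis (2 * pi * (of_int b / real A)) ^ A = 1"
    and "cis (2 * pi * (of_int b / real A)) = 1 \<longleftrightarrow> int A dvd b"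
proof -
  have "cis (2 * pi * (of_int b / real A)) ^ A = cis (2 * pi * of_int b)"
    using assms by (simp add: Complex.DeMoivre)
  also have "\<dots> = 1" by (rule cis_multiple_2pi) auto
  finally show "cis (2 * pi * (of_int b / real A)) ^ A = 1" .
  show "cis (2 * pi * (of_int b / real A)) = 1 \<longleftrightarrow> int A dvd b"
  proof
    assume "cis (2 * pi * (of_int b / real A)) = 1"
    then have "cos (2 * pi * (of_int b / real A)) = 1" by (simp add: complex_eq_iff)
    then obtain k :: int where "2 * pi * (of_int b / real A) = of_int k * 2 * pi"
      using cos_one_2pi_int by blast
    then have "of_int b = (of_int k * real A :: real)" using assms by (simp add: field_simps)
    then have "b = k * int A" by (metis of_int_eq_iff of_int_mult of_int_of_nat_eq)
    then show "int A dvd b" by simp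
  next
    assume "int A dvd b"
    then obtain k where "b = int A * k" by (elim dvdE)
    then have "2 * pi * (of_int b / real A) = 2 * pi * of_int k" using assms by simp
    then show "cis (2 * pi * (of_int b / real A)) = 1" by (metis cis_multiple_2pi Ints_of_int)
  qed
qed

text \<open>sin^2 sees only the doubled angle, so 2b must be nonzero modulo \<open>A\<close>; this
  is where oddness is needed.\<close>

lemma sin_squared_ge_mod:
  assumes "odd A" "\<not> int A dvd b"
  shows "sin (2 * pi * (of_int b / real A)) ^ 2 \<ge> 1 / real A ^ 2"
proof (rule sin_squared_ge_of_root_of_unity)
  have A: "A > 0" using assms(1) by (rule odd_pos)
  have "\<not> int A dvd 2 * b" using assms by (simp add: coprime_dvd_mult_right_iff coprime_commute)
  moreover have "2 * (2 * pi * (of_int b / real A)) = 2 * pi * (of_int (2 * b) / real A)" by simp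
  ultimately show "cis (2 * (2 * pi * (of_int b / real A))) ^ A = 1"
    "cis (2 * (2 * pi * (of_int b / real A))) \<noteq> 1" "A > 0"
    using cis_int_frac[OF A, of "2 * b"] A by (simp_all only: not_False_eq_True)
qed

text \<open>A nonzero solution modulo A of the recurrence with unit constant term cannot vanish on a window of length degree g: the window could be moved back to the initial values. So each window contributes at least 1 / A^2 to the exponent.\<close>

lemma prob_dvd_le:
  fixes d :: "int pmf" and g :: "int poly"
  assumes d: "set_pmf d \<subseteq> {-1, 0, 1}"
    and char: "\<And>t. norm (measure_pmf.expectation d (\<lambda>x. cis (of_int x * t))) \<le> exp (- \<kappa> * sin t ^ 2)"
    and \<kappa>: "\<kappa> > 0" and g: "lead_coeff g = 1" "\<bar>coeff g 0\<bar> = 1" and A: "odd A"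
  shows "measure_pmf.prob (coeff_law d n) {f. g dvd int_rand_poly n f}
     \<le> 1 / real A ^ degree g + exp (- \<kappa> * (real ((n + 1) div degree g) / real A ^ 2))"
proof -
  define e where "e = degree g"
  define N where "N = (n + 1) div e"
  define L where "L i = lin_rec_seq g (\<lambda>t. of_bool (t = i))" for i
  have A0: "A > 0" using A by (rule odd_pos)
  have "measure_pmf.prob (coeff_law d n) {f. g dvd int_rand_poly n f} \<le>
    measure_pmf.prob (coeff_law d n) {f. \<forall>i\<in>{..<e}. (\<Sum>j\<le>n. f j * L i j) = 0}"
  proof (rule measure_pmf.finite_measure_mono)
    show "{f. g dvd int_rand_poly n f} \<subseteq> {f. \<forall>i\<in>{..<e}. (\<Sum>j\<le>n. f j * L i j) = 0}"
      using lin_rec_seq_annihilates[OF g(1) _ degree_int_rand_poly]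
      by (auto simp: L_def coeff_int_rand_poly)
  qed auto
  also have "\<dots> \<le> 1 / (\<Prod>i\<in>{..<e}. real A) + exp (- \<kappa> * (real N / real A ^ 2))"
  proof (rule prob_linear_forms_vanish_le[OF d char \<kappa>])
    fix h assume h: "h \<in> PiE {..<e} (\<lambda>_. {..<A})" "\<exists>i\<in>{..<e}. h i \<noteq> 0"
    \<comment> \<open>By linearity the phase of the coefficient at j is \<open>b j / A\<close>,
      where \<open>b\<close> solves the recurrence with initial values \<open>h\<close>.\<close>
    define b where "b j = (\<Sum>i<e. int (h i) * L i j)" for j
    have binit: "b j = int (h j)" if "j < e" for j
      using that by (simp add: b_def L_def lin_rec_seq_init e_def if_distrib of_bool_def cong: if_cong)
    have brec: "(\<Sum>i\<le>e. coeff g i * b (t + i)) = 0" for t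
    proof -
      have "(\<Sum>i\<le>e. coeff g i * b (t + i)) = (\<Sum>i'<e. int (h i') * (\<Sum>i\<le>e. coeff g i * L i' (t + i)))"
        unfolding b_def sum_distrib_left by (subst sum.swap) (simp add: mult_ac)
      then show ?thesis using lin_rec_seq_rec[OF g(1)] by (simp add: L_def e_def)
    qed
    have win: "\<exists>j\<in>{t..<t + e}. \<not> int A dvd b j" for t
    proof (induction t)
      case 0
      obtain i where i: "i < e" "h i \<noteq> 0" using h(2) by auto
      moreover have "h i < A" using h(1) i by (auto simp: PiE_def Pi_def)
      ultimately have "\<not> int A dvd b i" by (auto simp: binit dest: dvd_imp_le)
      then show ?case using i by auto
    next
      case (Suc t)
      show ?case
      proof (rule ccontr)
        assume "\<not> ?case"
        then have *: "int A dvd b j" if "j \<in> {Suc t..<Suc t + e}" for j using that by blast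
        have e0: "e > 0" using h(2) by auto
        have "(\<Sum>i\<le>e. coeff g i * b (t + i)) = coeff g 0 * b t + (\<Sum>i<e. coeff g (Suc i) * b (t + Suc i))"
          by (simp add: sum.lessThan_Suc_shift flip: lessThan_Suc_atMost del: sum.lessThan_Suc)
        then have "coeff g 0 * b t = - (\<Sum>i<e. coeff g (Suc i) * b (t + Suc i))" using brec[of t] by simp
        moreover have "int A dvd (\<Sum>i<e. coeff g (Suc i) * b (t + Suc i))"
          by (intro dvd_sum dvd_mult *) auto
        ultimately have "int A dvd coeff g 0 * b t" by simp
        moreover have "coeff g 0 = 1 \<or> coeff g 0 = -1" using g(2) by auto
        ultimately have "int A dvd b t" by auto
        then have "int A dvd b j" if "j \<in> {t..<t + e}" for j using * that by (cases "j = t") auto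
        then show False using Suc by blast
      qed
    qed
    have arg: "(\<Sum>i<e. real (h i) * of_int (L i j) / real A) = of_int (b j) / real A" for j
      by (simp add: b_def sum_divide_distrib)
    define s where "s j = sin (2 * pi * (of_int (b j) / real A)) ^ 2" for j
    have "real N / real A ^ 2 = (\<Sum>w<N. 1 / real A ^ 2)" by simp
    also have "\<dots> \<le> (\<Sum>w<N. \<Sum>j\<in>{w * e..<w * e + e}. s j)"
    proof (rule sum_mono)
      fix w
      obtain j where j: "j \<in> {w * e..<w * e + e}" "\<not> int A dvd b j" using win by blast
      have "1 / real A ^ 2 \<le> s j" unfolding s_def by (rule sin_squared_ge_mod[OF A j(2)])
      also have "\<dots> \<le> (\<Sum>j\<in>{w * e..<w * e + e}. s j)"
        using j(1) by (intro member_le_sum) (auto simp: s_def)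
      finally show "1 / real A ^ 2 \<le> (\<Sum>j\<in>{w * e..<w * e + e}. s j)" .
    qed
    also have "\<dots> = (\<Sum>j<N * e. s j)" by (rule sum.nat_group)
    also have "\<dots> \<le> (\<Sum>j\<le>n. s j)"
    proof (rule sum_mono2)
      have "N * e \<le> n + 1" by (simp add: N_def)
      then show "{..<N * e} \<subseteq> {..n}" by auto
    qed (auto simp: s_def)
    finally show "real N / real A ^ 2 \<le>
      (\<Sum>j\<le>n. sin (2 * pi * (\<Sum>i<e. real (h i) * of_int (L i j) / real A)) ^ 2)"
      by (simp add: arg s_def)
  qed (use A0 in auto)
  finally show ?thesis by (simp add: e_def N_def)
qed

text \<open>With sin^2 y = (1 - cos 2y) / 2 the cosines form a geometric sum over a nontrivial
  \<open>M\<close>-th root of unity and cancel. The step 12 is the common period of the quadratic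
  recurrences; doubled to 24, it must stay invertible modulo \<open>M\<close>.\<close>

lemma sum_sin_squared_complete:
  assumes M: "coprime M 6" "\<not> int M dvd b"
  shows "(\<Sum>i<M. sin (x + 2 * pi * (of_int (12 * int i * b) / real M)) ^ 2) = real M / 2"
proof -
  have M0: "M > 0" using M(2) by (rule contrapos_np) (use M(1) in simp)
  define w where "w = cis (2 * pi * (of_int (24 * b) / real M))"
  have "coprime (int M) 24"
  proof -
    have "coprime (int M) 6" using M(1) by (metis coprime_int_iff of_nat_numeral)
    then have "coprime (int M) (6 ^ 3)" by (rule coprime_power_right_iff[THEN iffD2, OF disjI1])
    moreover have "(24 :: int) dvd 6 ^ 3" by simp
    ultimately show ?thesis using coprime_divisors[of "int M" "int M" 24 "6 ^ 3"] by simp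
  qed
  then have "\<not> int M dvd 24 * b" using M(2) by (simp add: coprime_dvd_mult_right_iff)
  then have w1: "w \<noteq> 1" and wM: "w ^ M = 1" using cis_int_frac[OF M0, of "24 * b"] by (simp_all add: w_def)
  have "(\<Sum>i<M. w ^ i) = 0" using w1 wM by (subst sum_gp_strict) auto
  then have 0: "Re (cis (2 * x) * (\<Sum>i<M. w ^ i)) = 0" by simp
  have "sin (x + 2 * pi * (of_int (12 * int i * b) / real M)) ^ 2 = (1 - Re (cis (2 * x) * w ^ i)) / 2" for i
  proof -
    have "cis (2 * x) * w ^ i = cis (2 * (x + 2 * pi * (of_int (12 * int i * b) / real M)))"
      by (simp add: w_def Complex.DeMoivre cis_mult algebra_simps)
    then have "Re (cis (2 * x) * w ^ i) = cos (2 * (x + 2 * pi * (of_int (12 * int i * b) / real M)))"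
      by (simp only: cis.sel)
    then show ?thesis by (simp only: cos_double_sin) simp
  qed
  then have "(\<Sum>i<M. sin (x + 2 * pi * (of_int (12 * int i * b) / real M)) ^ 2) =
    (\<Sum>i<M. (1 - Re (cis (2 * x) * w ^ i)) / 2)" by (simp only:)
  also have "\<dots> = (real M - (\<Sum>i<M. Re (cis (2 * x) * w ^ i))) / 2"
    by (simp only: sum_subtractf flip: sum_divide_distrib) simp
  also have "(\<Sum>i<M. Re (cis (2 * x) * w ^ i)) = Re (cis (2 * x) * (\<Sum>i<M. w ^ i))"
    by (simp only: sum_distrib_left Re_sum)
  also have "(real M - Re (cis (2 * x) * (\<Sum>i<M. w ^ i))) / 2 = real M / 2" by (simp only: 0) simp
  finally show ?thesis .
qed

text \<open>The roots of \<open>m\<close> are primitive roots of unity of order 3, 4 or 6, and 12 is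
  the least common multiple.\<close>

lemma lin_rec_seq_period_12:
  assumes "m = [:1, a, 1:]" "a \<in> {-1, 0, 1}"
  shows "lin_rec_seq m h (12 * i) = h 0" "lin_rec_seq m h (12 * i + 1) = h 1"
proof -
  define c where "c = lin_rec_seq m h"
  have r: "c (Suc (Suc j)) = - a * c (Suc j) - c j" for j
    unfolding c_def by (subst lin_rec_seq.simps) (simp add: assms(1) eval_nat_numeral)
  have p: "c (j + 12) = c j" for j
    using assms(2) by (auto simp: eval_nat_numeral r)
  have "c (12 * i + j) = c j" for j
    by (induction i) (use p[of "12 * _ + j"] in \<open>simp_all add: algebra_simps\<close>)
  from this[of 0] this[of 1] show "lin_rec_seq m h (12 * i) = h 0" "lin_rec_seq m h (12 * i + 1) = h 1"
    by (simp_all add: c_def lin_rec_seq_init assms(1))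
qed

text \<open>x p' is used in place of p' because its j-th coefficient is j times that of
  \<open>p\<close>, without a shift of the index.\<close>

lemma pderiv_square_dvd:
  fixes m p :: "int poly"
  assumes "m ^ 2 dvd p"
  shows "m dvd pCons 0 (pderiv p)"
proof -
  obtain q where q: "p = m ^ 2 * q" using assms by (elim dvdE)
  have "pderiv p = m * (m * pderiv q + 2 * pderiv m * q)"
    by (simp add: q pderiv_mult pderiv_power_Suc power2_eq_square algebra_simps)
  then have "m dvd [:0, 1:] * pderiv p" by (simp only: dvd_mult dvd_triv_left)
  then show ?thesis by simp
qed

text \<open>Frequencies \<open>h 0\<close>, \<open>h 1\<close> belong to m dvd P, and
  \<open>h 2\<close>, \<open>h 3\<close> to m dvd x P'. The positions 12 i isolate
  \<open>h 0\<close> and \<open>h 2\<close>; the positions 12 i + 1 isolate \<open>h 1\<close> and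
  \<open>h 3\<close>. If \<open>h 2\<close> is nonzero, the phases rotate with i and
  \<open>M\<close> positions give exactly M / 2; if \<open>h 2\<close> is 0 and \<open>h 0\<close>
  is not, the phase is constant and each position gives at least 1 / A^2. The other pair behaves in
  the same way.\<close>

lemma prob_quadratic_square_dvd_le:
  fixes d :: "int pmf" and a :: int
  assumes d: "set_pmf d \<subseteq> {-1, 0, 1}"
    and char: "\<And>t. norm (measure_pmf.expectation d (\<lambda>x. cis (of_int x * t))) \<le> exp (- \<kappa> * sin t ^ 2)"
    and \<kappa>: "\<kappa> > 0" and a: "a \<in> {-1, 0, 1}"
    and A: "odd A" "A \<ge> 3" and M: "coprime M 6" "12 * M \<le> n"
  shows "measure_pmf.prob (coeff_law d n) {f. [:1, a, 1:] ^ 2 dvd int_rand_poly n f}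
     \<le> 1 / (real A ^ 2 * real M ^ 2) + exp (- \<kappa> * (real M / real A ^ 2))"
proof -
  define m where "m = [:1, a, 1:]"
  define u v where "u = lin_rec_seq m (\<lambda>t. of_bool (t = 0))" and "v = lin_rec_seq m (\<lambda>t. of_bool (t = 1))"
  define L where "L i j = (if i = 0 then u j else if i = 1 then v j else
    if i = 2 then int j * u j else int j * v j)" for i j :: nat
  \<comment> \<open>A small modulus for the first pair keeps the constant-phase contribution M / A^2
    large. The second pair, weighted by j, suffers no such loss.\<close>
  define q where "q i = (if i < 2 then A else M)" for i :: nat
  have lm: "lead_coeff m = 1" by (simp add: m_def)
  have uv: "u (12 * i) = 1" "v (12 * i) = 0" "u (12 * i + 1) = 0" "v (12 * i + 1) = 1" for i
    using lin_rec_seq_period_12[OF m_def a] by (simp_all add: u_def v_def)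
  have M0: "M > 0" by (rule ccontr) (use M(1) in simp)
  have "measure_pmf.prob (coeff_law d n) {f. m ^ 2 dvd int_rand_poly n f} \<le>
    measure_pmf.prob (coeff_law d n) {f. \<forall>i\<in>{..<4}. (\<Sum>j\<le>n. f j * L i j) = 0}"
  proof (rule measure_pmf.finite_measure_mono)
    show "{f. m ^ 2 dvd int_rand_poly n f} \<subseteq> {f. \<forall>i\<in>{..<4}. (\<Sum>j\<le>n. f j * L i j) = 0}"
    proof safe
      fix f and i :: nat assume dv: "m ^ 2 dvd int_rand_poly n f" and i: "i < 4"
      define p where "p = int_rand_poly n f"
      define p' where "p' = pCons 0 (pderiv p)"
      have 1: "m dvd p" using dv by (metis p_def dvd_mult_left power2_eq_square)
      have 2: "m dvd p'" unfolding p'_def p_def by (rule pderiv_square_dvd[OF dv])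
      have cp': "coeff p' j = int j * coeff p j" for j
        by (cases j) (simp_all add: p'_def coeff_pderiv)
      have dp: "degree p \<le> n" by (simp add: p_def degree_int_rand_poly)
      then have dp': "degree p' \<le> n" by (intro degree_le) (auto simp: cp' coeff_eq_0)
      have cp: "coeff p j = f j" if "j \<le> n" for j using that by (simp add: p_def coeff_int_rand_poly)
      have "(\<Sum>j\<le>n. f j * L 0 j) = 0" "(\<Sum>j\<le>n. f j * L 1 j) = 0"
        using lin_rec_seq_annihilates[OF lm 1 dp] by (simp_all add: L_def u_def v_def cp)
      moreover have "(\<Sum>j\<le>n. f j * L 2 j) = 0" "(\<Sum>j\<le>n. f j * L 3 j) = 0"
        using lin_rec_seq_annihilates[OF lm 2 dp'] by (simp_all add: L_def u_def v_def cp cp' mult_ac)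
      moreover have "i = 0 \<or> i = 1 \<or> i = 2 \<or> i = 3" using i by linarith
      ultimately show "(\<Sum>j\<le>n. f j * L i j) = 0" by metis
    qed
  qed auto
  also have "\<dots> \<le> 1 / (\<Prod>i\<in>{..<4}. real (q i)) + exp (- \<kappa> * (real M / real A ^ 2))"
  proof (rule prob_linear_forms_vanish_le[OF d char \<kappa>])
    show "q i > 0" for i using A M0 by (simp add: q_def)
    fix h assume h: "h \<in> PiE {..<4} (\<lambda>i. {..<q i})" "\<exists>i\<in>{..<4}. h i \<noteq> 0"
    define s where "s j = sin (2 * pi * (\<Sum>i<4. real (h i) * of_int (L i j) / real (q i))) ^ 2" for j
    have hq: "h i < q i" if "i < 4" for i using h(1) that by (auto simp: PiE_def Pi_def)
    have s0: "s (12 * i) = sin (2 * pi * (real (h 0) / real A) + 2 * pi * (of_int (12 * int i * int (h 2)) / real M)) ^ 2" for i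
      unfolding s_def using uv[of i]
      by (simp add: eval_nat_numeral L_def q_def algebra_simps)
    have s1: "s (12 * i + 1) = sin ((2 * pi * (real (h 1) / real A) + 2 * pi * (real (h 3) / real M)) + 2 * pi * (of_int (12 * int i * int (h 3)) / real M)) ^ 2" for i
      unfolding s_def using uv[of i]
      by (simp add: eval_nat_numeral L_def q_def algebra_simps add_divide_distrib)
    have AM: "real M / real A ^ 2 \<le> real M / 2"
    proof -
      have "(2 :: real) \<le> 3 ^ 2" by simp
      also have "\<dots> \<le> real A ^ 2" using A by (intro power_mono) auto
      finally show ?thesis using A by (intro divide_left_mono) auto
    qed
    have M3: "\<not> int M dvd int k" if "0 < k" "k < M" for k using that by (auto dest: dvd_imp_le)
    have A3: "\<not> int A dvd int k" if "0 < k" "k < A" for k using that by (auto dest: dvd_imp_le)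
    have Aconst: "real M / real A ^ 2 \<le> (\<Sum>i<M. sin (2 * pi * (real k / real A)) ^ 2)" if "0 < k" "k < A" for k
    proof -
      have "1 / real A ^ 2 \<le> sin (2 * pi * (real k / real A)) ^ 2"
        using sin_squared_ge_mod[OF A(1) A3[OF that]] by simp
      then have "real M * (1 / real A ^ 2) \<le> real M * sin (2 * pi * (real k / real A)) ^ 2"
        by (intro mult_left_mono) auto
      then show ?thesis by simp
    qed
    have "real M / real A ^ 2 \<le> (\<Sum>i<M. s (12 * i)) \<or> real M / real A ^ 2 \<le> (\<Sum>i<M. s (12 * i + 1))"
    proof -
      have "h 0 > 0 \<or> h 1 > 0 \<or> h 2 > 0 \<or> h 3 > 0"
        using h(2) by (auto simp: eval_nat_numeral less_Suc_eq)
      then consider "h 2 > 0" | "h 3 > 0" | "h 2 = 0" "h 0 > 0" | "h 3 = 0" "h 1 > 0"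
        by (cases "h 2 = 0"; cases "h 3 = 0") auto
      then show ?thesis
      proof cases
        case 1
        then have "\<not> int M dvd int (h 2)" using hq[of 2] by (intro M3) (auto simp: q_def)
        then have "(\<Sum>i<M. s (12 * i)) = real M / 2" unfolding s0 by (rule sum_sin_squared_complete[OF M(1)])
        then show ?thesis using AM by linarith
      next
        case 2
        then have "\<not> int M dvd int (h 3)" using hq[of 3] by (intro M3) (auto simp: q_def)
        then have "(\<Sum>i<M. s (12 * i + 1)) = real M / 2" unfolding s1 by (rule sum_sin_squared_complete[OF M(1)])
        then show ?thesis using AM by linarith
      next
        case 3
        then show ?thesis using Aconst[of "h 0"] hq[of 0] by (simp add: s0 q_def)
      next
        case 4
        then show ?thesis using Aconst[of "h 1"] hq[of 1] unfolding s1 by (simp add: q_def)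
      qed
    qed
    moreover have "(\<Sum>i<M. s (12 * i + r)) \<le> (\<Sum>j\<le>n. s j)" if "r \<le> 1" for r
    proof -
      have "(\<Sum>i<M. s (12 * i + r)) = (\<Sum>j\<in>(\<lambda>i. 12 * i + r) ` {..<M}. s j)"
        by (subst sum.reindex) (auto simp: inj_on_def)
      also have "\<dots> \<le> (\<Sum>j\<le>n. s j)"
        using M(2) that by (intro sum_mono2) (auto simp: s_def)
      finally show ?thesis .
    qed
    from this[of 0] this[of 1] have "(\<Sum>i<M. s (12 * i)) \<le> (\<Sum>j\<le>n. s j)" "(\<Sum>i<M. s (12 * i + 1)) \<le> (\<Sum>j\<le>n. s j)"
      by simp_all
    ultimately show "real M / real A ^ 2 \<le>
      (\<Sum>j\<le>n. sin (2 * pi * (\<Sum>i<4. real (h i) * of_int (L i j) / real (q i))) ^ 2)"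
      unfolding s_def[symmetric] by linarith
  qed auto
  also have "(\<Prod>i\<in>{..<4::nat}. real (q i)) = real A ^ 2 * real M ^ 2"
    by (simp add: eval_nat_numeral q_def)
  finally show ?thesis by (simp add: m_def)
qed

text \<open>The two moduli have product 1 and exceed 2/3, so their sum is below 2/3 + 3/2 = 13/6 and
  |a| <= 2. For b = 1, the values 2 and -2 of \<open>a\<close> would produce a root -1 or 1. For b =
  -1, the squared distance of the roots is a^2 + 4 >= 5, which exceeds (13/6)^2.\<close>

lemma quadratic_unit_poly_cases:
  fixes m :: "int poly"
  assumes m: "degree m = 2" "lead_coeff m = 1" "\<bar>coeff m 0\<bar> = 1" "poly m 1 \<noteq> 0" "poly m (-1) \<noteq> 0"
    and roots: "\<And>z. poly (cpoly m) z = 0 \<Longrightarrow> norm z > 2 / 3"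
  shows "\<exists>a\<in>{-1, 0, 1}. m = [:1, a, 1:]"
proof -
  define a b where "a = coeff m 1" and "b = coeff m 0"
  have meq: "m = [:b, a, 1:]"
  proof (rule poly_eqI)
    fix i :: nat
    consider "i = 0" | "i = 1" | "i = 2" | "i > 2" by linarith
    then show "coeff m i = coeff [:b, a, 1:] i"
      using m(1,2) by cases (auto simp: a_def b_def coeff_eq_0 eval_nat_numeral coeff_pCons split: nat.splits)
  qed
  obtain z where "smult (lead_coeff (cpoly m)) (\<Prod>i<degree (cpoly m). [:- z i, 1:]) = cpoly m"
    using complex_poly_decompose' by blast
  then have dec: "cpoly m = [:- z 0, 1:] * [:- z 1, 1:]" using m(1,2) by (simp add: eval_nat_numeral)
  define x y where "x = z 0" and "y = z 1"
  have cm: "cpoly m = [:of_int b, of_int a, 1:]" by (simp add: meq map_poly_pCons)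
  have xy: "x * y = of_int b" "x + y = - of_int a"
  proof -
    have "of_int b = x * y" "of_int a = - x - y"
      using dec unfolding cm by (auto simp: x_def y_def)
    then show "x * y = of_int b" "x + y = - of_int a" by simp_all
  qed
  have nx: "norm x > 2 / 3" and ny: "norm y > 2 / 3"
    by (rule roots, simp add: dec x_def y_def)+
  have b: "b = 1 \<or> b = -1" using m(3) by (auto simp: b_def)
  have nxy: "norm x * norm y = 1" using arg_cong[OF xy(1), of norm] b by (auto simp: norm_mult)
  define s where "s = norm x + norm y"
  have s: "s < 13 / 6"
  proof -
    have "norm x * (2 / 3) < norm x * norm y" using nx ny by (intro mult_strict_left_mono) auto
    then have "norm x < 3 / 2" using nxy by simp
    then have "(norm x - 2 / 3) * (3 / 2 - norm x) > 0" using nx by simp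
    then have "norm x * norm x + 1 < norm x * (13 / 6)" by (simp add: algebra_simps)
    moreover have "norm x * s = norm x * norm x + 1" using nxy by (simp add: s_def algebra_simps)
    ultimately have "norm x * s < norm x * (13 / 6)" by simp
    moreover have "norm x > 0" using nx by linarith
    ultimately show ?thesis by (metis mult_less_cancel_left_pos)
  qed
  have "\<bar>real_of_int a\<bar> = norm (x + y)" by (simp add: xy)
  also have "\<dots> \<le> s" unfolding s_def by (rule norm_triangle_ineq)
  finally have "\<bar>a\<bar> \<le> 2" using s by linarith
  have p: "1 + a + b \<noteq> 0" "1 - a + b \<noteq> 0" using m(4,5) by (simp_all add: meq algebra_simps)
  from b show ?thesis
  proof
    assume "b = 1"
    then have "a \<in> {-1, 0, 1}" using \<open>\<bar>a\<bar> \<le> 2\<close> p by auto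
    then show ?thesis using meq \<open>b = 1\<close> by blast
  next
    assume b1: "b = -1"
    have "a ^ 2 \<ge> 1" using p b1 by (simp add: int_one_le_iff_zero_less)
    have "(x - y) ^ 2 = (x + y) ^ 2 - 4 * (x * y)" by (simp add: power2_eq_square algebra_simps)
    also have "\<dots> = of_int (a ^ 2 + 4)" by (simp add: xy b1)
    finally have "norm (x - y) ^ 2 = real_of_int (a ^ 2 + 4)"
      by (metis norm_power norm_of_int abs_of_nonneg of_int_0_le_iff zero_le_power2 add_nonneg_nonneg zero_le_numeral)
    moreover have "norm (x - y) ^ 2 \<le> s ^ 2"
      unfolding s_def by (intro power_mono norm_triangle_ineq4) auto
    moreover have "s ^ 2 \<le> (13 / 6) ^ 2" using s by (intro power_mono) (auto simp: s_def)
    ultimately have "real_of_int (a ^ 2 + 4) \<le> (13 / 6) ^ 2" by linarith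
    moreover have "real_of_int (a ^ 2 + 4) \<ge> 5" using \<open>a ^ 2 \<ge> 1\<close> by linarith
    ultimately show ?thesis by (simp add: power2_eq_square)
  qed
qed

section \<open>The four cases\<close>

lemma prob_UN_le:
  assumes "finite I" "\<And>i. i \<in> I \<Longrightarrow> measure_pmf.prob P (F i) \<le> b i"
  shows "measure_pmf.prob P (\<Union>i\<in>I. F i) \<le> (\<Sum>i\<in>I. b i)"
proof -
  have "measure_pmf.prob P (\<Union>i\<in>I. F i) \<le> (\<Sum>i\<in>I. measure_pmf.prob P (F i))"
    by (rule measure_pmf.finite_measure_subadditive_finite) (use assms(1) in auto)
  also have "\<dots> \<le> (\<Sum>i\<in>I. b i)" by (intro sum_mono assms(2))
  finally show ?thesis .
qed

lemma prob_UN_card_le: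
  assumes "finite I" "\<And>i. i \<in> I \<Longrightarrow> measure_pmf.prob P (F i) \<le> b" "real (card I) \<le> c" "b \<ge> 0"
  shows "measure_pmf.prob P (\<Union>i\<in>I. F i) \<le> c * b"
proof -
  have "measure_pmf.prob P (\<Union>i\<in>I. F i) \<le> (\<Sum>i\<in>I. b)" using assms(1,2) by (rule prob_UN_le)
  also have "\<dots> \<le> c * b" using assms(3,4) by (simp add: mult_right_mono)
  finally show ?thesis .
qed

lemma unit_poly_eval_3_ge:
  assumes "unit_poly m"
  shows "(5 / 4) ^ degree m \<le> \<bar>real_of_int (poly m 3)\<bar>"
proof -
  define k where "k = degree m"
  have l: "lead_coeff m = 1" "\<bar>coeff m 0\<bar> = 1" using assms by (auto simp: unit_poly_def)
  obtain z where "smult (lead_coeff (cpoly m)) (\<Prod>i<degree (cpoly m). [:- z i, 1:]) = cpoly m"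
    using complex_poly_decompose' by blast
  then have dec: "cpoly m = (\<Prod>i<k. [:- z i, 1:])" using l by (simp add: k_def)
  have z: "1 / 2 < norm (z i) \<and> norm (z i) < 2" if "i < k" for i
  proof -
    have "poly (cpoly m) (z i) = 0" using that by (auto simp: dec poly_prod intro!: prod_zero)
    then show ?thesis using assms by (auto simp: unit_poly_def)
  qed
  have "poly (cpoly m) 0 = of_int (coeff m 0)" by (simp add: poly_cpoly_numeral poly_0_coeff_0)
  then have "norm (\<Prod>i<k. - z i) = 1" using l(2) by (auto simp: dec poly_prod simp flip: of_int_abs)
  then have p1: "(\<Prod>i<k. norm (z i)) = 1" by (simp flip: prod_norm)
  have "(5 / 4) ^ k = (\<Prod>i<k. 5 / 4 :: real)" by simp
  also have "\<dots> \<le> (\<Prod>i<k. norm (3 - z i) * norm (z i))"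
  proof (rule prod_mono)
    fix i assume "i \<in> {..<k}"
    then have zi: "1 / 2 < norm (z i)" "norm (z i) < 2" using z by auto
    have "0 \<le> (norm (z i) - 1 / 2) * (5 / 2 - norm (z i))" using zi by (intro mult_nonneg_nonneg) auto
    then have "5 / 4 \<le> (3 - norm (z i)) * norm (z i)" by (simp add: algebra_simps)
    also have "\<dots> \<le> norm (3 - z i) * norm (z i)"
      using norm_triangle_ineq2[of 3 "z i"] by (intro mult_right_mono) auto
    finally show "0 \<le> (5 / 4 :: real) \<and> 5 / 4 \<le> norm (3 - z i) * norm (z i)" by simp
  qed
  also have "\<dots> = (\<Prod>i<k. norm (3 - z i))" by (simp add: prod.distrib p1)
  also have "\<dots> = norm (poly (cpoly m) 3)" by (simp add: dec poly_prod prod_norm)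
  also have "\<dots> = \<bar>real_of_int (poly m 3)\<bar>" by (simp only: poly_cpoly_numeral norm_of_int)
  finally show ?thesis by (simp add: k_def)
qed

text \<open>Squares are grouped by their order of magnitude in base 3, on which alone the bound p^J
  depends. The range of \<open>J\<close> ends at \<open>n\<close> because |P(3)| < 3^(n+1).\<close>

definition large_square_event :: "nat \<Rightarrow> nat \<Rightarrow> (nat \<Rightarrow> int) set" where
  "large_square_event n J0 = (\<Union>J\<in>{J0..n}. \<Union>k\<in>{k. k > 0 \<and> 3 ^ J \<le> k\<^sup>2 \<and> k\<^sup>2 < 3 ^ (J + 1)}.
     {f. int (k\<^sup>2) dvd (\<Sum>j\<le>n. f j * 3 ^ j)})"

text \<open>The threshold serves both sides: (1 + 1/k)^k >= 2 gives |z|^(2k) <= 1/4 for a root below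
  it, and (1 + 1/k)^k <= 3 keeps the Newton sums small when all roots lie above it.\<close>

definition small_root_event :: "nat \<Rightarrow> nat \<Rightarrow> (nat \<Rightarrow> int) set" where
  "small_root_event n D = (\<Union>k\<in>{2..<D}. \<Union>m\<in>{m. unit_poly m \<and> degree m = k \<and>
       (\<exists>z. poly (cpoly m) z = 0 \<and> norm z \<le> 1 / (1 + 1 / real k))}.
     {f. m dvd int_rand_poly n f})"

definition square_factor_event :: "nat \<Rightarrow> nat \<Rightarrow> (nat \<Rightarrow> int) set" where
  "square_factor_event n D = (\<Union>k\<in>{3..<D}. \<Union>m\<in>{m. unit_poly m \<and> degree m = k \<and>
       (\<forall>z. poly (cpoly m) z = 0 \<longrightarrow> 1 / (1 + 1 / real k) \<le> norm z)}.
     {f. m ^ 2 dvd int_rand_poly n f})"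

definition quadratic_event :: "nat \<Rightarrow> (nat \<Rightarrow> int) set" where
  "quadratic_event n = (\<Union>a\<in>{-1, 0, 1}. {f. [:1, a, 1:] ^ 2 dvd int_rand_poly n f})"

lemma poly_int_rand_poly: "poly (int_rand_poly n f) x = (\<Sum>j\<le>n. f j * x ^ j)"
  by (simp add: int_rand_poly_def poly_sum poly_monom)

lemma double_root_event_cover:
  assumes f: "\<And>j. f j \<in> {-1, 0, 1}"
    and z: "double_root (rand_poly n f) z"
    and no: "\<not> (\<exists>z\<in>{-1, 0, 1}. double_root (rand_poly n f) z)"
  shows "f \<in> large_square_event n J0 \<union> small_root_event n (3 * J0) \<union>
    square_factor_event n (3 * J0) \<union> quadratic_event n"
proof -
  define p where "p = int_rand_poly n f"
  obtain m where m: "unit_poly m" "m ^ 2 dvd p" "degree m \<ge> 2" "poly m 1 \<noteq> 0" "poly m (-1) \<noteq> 0"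
    using double_root_factor[OF f z no] unfolding p_def by blast
  have mp: "m dvd p" using m(2) by (metis dvd_mult_left power2_eq_square)
  define k where "k = degree m"
  show ?thesis
  proof (cases "k \<ge> 3 * J0")
    case True
    define K where "K = nat \<bar>poly m 3\<bar>"
    have K2: "int (K\<^sup>2) = poly m 3 ^ 2" by (simp add: K_def)
    \<comment> \<open>The degree bound 3 J0 comes from (5/4)^6 = (25/16)^3 > 3.\<close>
    have "3 ^ J0 \<le> ((25 / 16) ^ 3 :: real) ^ J0" by (intro power_mono) (auto simp: power3_eq_cube)
    also have "\<dots> = (25 / 16) ^ (3 * J0)" by (simp add: power_mult)
    also have "\<dots> \<le> (25 / 16) ^ k" using True by (intro power_increasing) auto
    also have "\<dots> = ((5 / 4) ^ k) ^ 2" by (simp add: power2_eq_square flip: power_mult_distrib)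
    also have "\<dots> \<le> \<bar>real_of_int (poly m 3)\<bar> ^ 2"
      unfolding k_def by (intro power_mono unit_poly_eval_3_ge m) auto
    also have "\<dots> = real (K\<^sup>2)" by (simp add: K_def)
    finally have "real (3 ^ J0) \<le> real (K\<^sup>2)" by simp
    then have J0: "3 ^ J0 \<le> K\<^sup>2" by (simp only: of_nat_le_iff)
    have "0 < (3 :: nat) ^ J0" by simp
    then have K1: "K\<^sup>2 \<ge> 1" using J0 by linarith
    then have K0: "K > 0" by (cases K) auto
    obtain J where J: "3 ^ J \<le> K\<^sup>2" "K\<^sup>2 < 3 ^ (J + 1)"
      using ex_power_ivl1[of 3 "K\<^sup>2"] K1 by auto
    have "3 ^ J0 < (3 :: nat) ^ (J + 1)" using J0 J(2) by linarith
    then have "J0 \<le> J" by (simp add: power_strict_increasing_iff del: power_Suc)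
    define S where "S = (\<Sum>j\<le>n. f j * 3 ^ j)"
    have dv: "int (K\<^sup>2) dvd S"
    proof -
      obtain q where "p = m ^ 2 * q" using m(2) by (elim dvdE)
      then have "S = int (K\<^sup>2) * poly q 3"
        unfolding K2 S_def by (simp add: p_def flip: poly_int_rand_poly)
      then show ?thesis by simp
    qed
    have fb: "\<bar>if j \<le> n then f j else 0\<bar> \<le> 2" for j using f[of j] by auto
    have S': "S = (\<Sum>j<n + 1. (if j \<le> n then f j else 0) * 3 ^ j)"
      unfolding S_def by (simp add: lessThan_Suc_atMost)
    \<comment> \<open>Needed to bound the divisor by |S|. By uniqueness of digits S = 0 would force
      P = 0, and the zero polynomial has 0 as a double root in the sense of divisibility.\<close>
    have "S \<noteq> 0"
    proof
      assume "S = 0"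
      then have "(if j \<le> n then f j else 0) = 0" for j
        using ternary_sum_eq_0[of "\<lambda>j. if j \<le> n then f j else 0" "n + 1" j] fb unfolding S'
        by (cases "j \<le> n") auto
      then have "p = 0" by (intro poly_eqI) (simp add: p_def coeff_int_rand_poly)
      then have "double_root (rand_poly n f) 0" by (simp add: rand_poly_eq p_def[symmetric] double_root_def)
      then show False using no by auto
    qed
    then have "int (K\<^sup>2) \<le> \<bar>S\<bar>" using dvd_imp_le_int[OF _ dv] by simp
    also have "\<dots> < 3 ^ (n + 1)" unfolding S' by (rule ternary_sum_abs_less) (rule fb)
    finally have "int (K\<^sup>2) < int (3 ^ (n + 1))" by simp
    then have "K\<^sup>2 < 3 ^ (n + 1)" by (simp only: of_nat_less_iff)
    with J(1) have "(3 :: nat) ^ J < 3 ^ (n + 1)" by (rule le_less_trans)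
    then have "J \<le> n" by (simp add: power_strict_increasing_iff del: power_Suc)
    then have "f \<in> large_square_event n J0"
      unfolding large_square_event_def using J K0 dv \<open>J0 \<le> J\<close> by (auto simp: S_def)
    then show ?thesis by blast
  next
    case False
    have k2: "k \<ge> 2" using m by (simp add: k_def)
    show ?thesis
    proof (cases "\<exists>z. poly (cpoly m) z = 0 \<and> norm z \<le> 1 / (1 + 1 / real k)")
      case True
      then have "f \<in> small_root_event n (3 * J0)"
        unfolding small_root_event_def using False k2 m(1) mp
        by (intro UN_I[of k] UN_I[of m]) (auto simp: p_def k_def)
      then show ?thesis by blast
    next
      case no_small: False
      show ?thesis
      proof (cases "k = 2")
        case True
        have "norm z > 2 / 3" if "poly (cpoly m) z = 0" for z
          using no_small that by (force simp: True)
        then obtain a where "a \<in> {-1, 0, 1}" "m = [:1, a, 1:]"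
          using quadratic_unit_poly_cases[of m] m True by (auto simp: unit_poly_def k_def)
        then have "f \<in> quadratic_event n" unfolding quadratic_event_def using m(2) by (auto simp: p_def)
        then show ?thesis by blast
      next
        case k: False
        have "\<forall>z. poly (cpoly m) z = 0 \<longrightarrow> 1 / (1 + 1 / real k) \<le> norm z" using no_small by force
        then have "f \<in> square_factor_event n (3 * J0)"
          unfolding square_factor_event_def using False k k2 m(1,2)
          by (intro UN_I[of k] UN_I[of m]) (auto simp: p_def k_def)
        then show ?thesis by blast
      qed
    qed
  qed
qed

section \<open>Probabilities of the four events\<close>

lemma prob_large_square_le:
  fixes d :: "int pmf"
  assumes d: "set_pmf d \<subseteq> {-1, 0, 1}" and p: "\<And>x. pmf d x \<le> p" "0 \<le> p" "sqrt 3 * p < 1"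
  shows "measure_pmf.prob (coeff_law d n) (large_square_event n J0)
    \<le> sqrt 3 * ((sqrt 3 * p) ^ J0 / (1 - sqrt 3 * p))"
proof -
  define K where "K J = {k :: nat. k > 0 \<and> 3 ^ J \<le> k\<^sup>2 \<and> k\<^sup>2 < 3 ^ (J + 1)}" for J
  have K: "finite (K J)" "real (card (K J)) \<le> sqrt 3 ^ (J + 1)" for J
  proof -
    \<comment> \<open>At most sqrt 3 ^ (J + 1) squares compete, each with probability at most p^J;
      the resulting geometric series has ratio sqrt 3 * p.\<close>
    have sub: "K J \<subseteq> {1..nat \<lfloor>sqrt 3 ^ (J + 1)\<rfloor>}"
    proof
      fix k assume "k \<in> K J"
      then have k: "k > 0" "k\<^sup>2 < 3 ^ (J + 1)" by (auto simp: K_def)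
      have "real k ^ 2 < 3 ^ (J + 1)" using k(2) by (metis of_nat_less_iff of_nat_numeral of_nat_power)
      also have "\<dots> = (sqrt 3 ^ (J + 1)) ^ 2"
        by (metis power_mult mult.commute real_sqrt_pow2 zero_le_numeral)
      finally have "real k ^ 2 \<le> (sqrt 3 ^ (J + 1)) ^ 2" by (rule less_imp_le)
      then have "real k \<le> sqrt 3 ^ (J + 1)" by (rule power2_le_imp_le) simp
      then show "k \<in> {1..nat \<lfloor>sqrt 3 ^ (J + 1)\<rfloor>}" using k by (simp add: le_nat_floor)
    qed
    then show "finite (K J)" by (rule finite_subset) simp
    have "card (K J) \<le> nat \<lfloor>sqrt 3 ^ (J + 1)\<rfloor>" using card_mono[OF _ sub] by simp
    moreover have "real (nat \<lfloor>sqrt 3 ^ (J + 1)\<rfloor>) \<le> sqrt 3 ^ (J + 1)" by (intro of_nat_floor) simp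
    ultimately show "real (card (K J)) \<le> sqrt 3 ^ (J + 1)" by linarith
  qed
  have "measure_pmf.prob (coeff_law d n) (large_square_event n J0)
    \<le> (\<Sum>J\<in>{J0..n}. sqrt 3 ^ (J + 1) * p ^ J)"
    unfolding large_square_event_def K_def[symmetric]
  proof (rule prob_UN_le)
    fix J assume J: "J \<in> {J0..n}"
    show "measure_pmf.prob (coeff_law d n) (\<Union>k\<in>K J. {f. int (k\<^sup>2) dvd (\<Sum>j\<le>n. f j * 3 ^ j)})
      \<le> sqrt 3 ^ (J + 1) * p ^ J"
    proof (rule prob_UN_card_le)
      fix k assume "k \<in> K J"
      then have "3 ^ J \<le> k\<^sup>2" by (simp add: K_def)
      then have "int (3 ^ J) \<le> int (k\<^sup>2)" by (simp only: of_nat_le_iff)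
      then show "measure_pmf.prob (coeff_law d n) {f. int (k\<^sup>2) dvd (\<Sum>j\<le>n. f j * 3 ^ j)} \<le> p ^ J"
        using J by (intro prob_dvd_eval_3_le[OF d p(1)]) auto
    qed (use K p in auto)
  qed auto
  also have "\<dots> = sqrt 3 * (\<Sum>J\<in>{J0..n}. (sqrt 3 * p) ^ J)"
    by (simp add: sum_distrib_left power_mult_distrib mult_ac)
  also have "(\<Sum>J\<in>{J0..n}. (sqrt 3 * p) ^ J) \<le> (sqrt 3 * p) ^ J0 / (1 - sqrt 3 * p)"
    using p by (auto simp: sum_gp intro!: divide_right_mono)
  finally show ?thesis by simp
qed

lemma poly_cpoly_int_rand_poly:
  "poly (cpoly (int_rand_poly n f)) z = (\<Sum>j\<le>n. of_int (f j) * z ^ j)"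
  by (simp add: rand_poly_def poly_sum poly_monom flip: rand_poly_eq)

lemma one_plus_inverse_power_ge_2:
  assumes "k > 0"
  shows "2 \<le> (1 + 1 / real k) ^ k"
proof -
  have "-1 \<le> 1 / real k" by (rule order_trans[of _ 0]) auto
  then show ?thesis using Bernoulli_inequality[of "1 / real k" k] assms by simp
qed

lemma one_plus_inverse_power_le_3:
  assumes "k > 0"
  shows "(1 + 1 / real k) ^ k \<le> 3"
proof -
  have "(1 + 1 / real k) ^ k \<le> exp (1 / real k) ^ k" by (intro power_mono exp_ge_add_one_self) auto
  also have "\<dots> = exp 1" using assms by (simp flip: exp_of_nat_mult)
  finally show ?thesis using exp_le by linarith
qed

text \<open>Apart from the small root only |z| > 1/2 is known, so the count uses
  \<open>r = 2\<close>. The resulting exp(O(D^2)) is absorbed by the power of \<open>p\<close> when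
  \<open>D\<close> is logarithmic in \<open>n\<close>.\<close>

lemma prob_small_root_event_le:
  fixes d :: "int pmf"
  assumes d: "set_pmf d \<subseteq> {-1, 0, 1}" and p: "\<And>x. pmf d x \<le> p" "0 \<le> p" "p \<le> 1"
  shows "measure_pmf.prob (coeff_law d n) (small_root_event n D)
    \<le> real D * (2 * (2 * real D * 2 ^ D + 1) ^ D * p ^ (n div (2 * D)))"
  unfolding small_root_event_def
proof (rule prob_UN_card_le)
  fix k assume k: "k \<in> {2..<D}"
  define M where "M = {m. unit_poly m \<and> degree m = k \<and> (\<exists>z. poly (cpoly m) z = 0 \<and> norm z \<le> 1 / (1 + 1 / real k))}"
  define T where "T = {m :: int poly. degree m = k \<and> \<bar>coeff m 0\<bar> = 1 \<and> (\<forall>z. poly (cpoly m) z = 0 \<longrightarrow> 1 / 2 \<le> norm z)}"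
  have sub: "M \<subseteq> T" by (force simp: M_def T_def unit_poly_def)
  have T: "finite T" "card T \<le> 2 * (2 * (k * 2 ^ k) + 1) ^ k"
    using card_unit_polys_le[of 2 k "k * 2 ^ k", folded T_def] by simp_all
  show "measure_pmf.prob (coeff_law d n) (\<Union>m\<in>M. {f. m dvd int_rand_poly n f})
     \<le> 2 * (2 * real D * 2 ^ D + 1) ^ D * p ^ (n div (2 * D))"
  proof (rule prob_UN_card_le)
    show "finite M" using sub T(1) by (rule finite_subset)
    have "card M \<le> 2 * (2 * (k * 2 ^ k) + 1) ^ k" using card_mono[OF T(1) sub] T(2) by linarith
    also have "\<dots> \<le> 2 * (2 * (D * 2 ^ D) + 1) ^ k"
      using k by (intro mult_le_mono2 power_mono add_mono mult_le_mono power_increasing) auto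
    also have "\<dots> \<le> 2 * (2 * (D * 2 ^ D) + 1) ^ D"
      using k by (intro mult_le_mono2 power_increasing) auto
    finally have "real (card M) \<le> real (2 * (2 * (D * 2 ^ D) + 1) ^ D)" by (simp only: of_nat_le_iff)
    then show "real (card M) \<le> 2 * (2 * real D * 2 ^ D + 1) ^ D" by (simp add: mult.assoc add.commute)
    fix m assume "m \<in> M"
    then obtain z where z: "unit_poly m" "poly (cpoly m) z = 0" "norm z \<le> 1 / (1 + 1 / real k)"
      by (auto simp: M_def)
    have z0: "z \<noteq> 0" using z(1,2) by (auto simp: unit_poly_def)
    have "norm z ^ (2 * k) \<le> (1 / (1 + 1 / real k)) ^ (2 * k)" by (intro power_mono z) auto
    also have "\<dots> = 1 / ((1 + 1 / real k) ^ k) ^ 2"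
      by (simp add: power_divide mult.commute flip: power_mult)
    also have "\<dots> \<le> 1 / 2 ^ 2"
      using k one_plus_inverse_power_ge_2[of k] by (intro frac_le power_mono) auto
    finally have zp: "norm z ^ (2 * k) \<le> 1 / 4" by simp
    have "measure_pmf.prob (coeff_law d n) {f. m dvd int_rand_poly n f} \<le>
      measure_pmf.prob (coeff_law d n) {f. (\<Sum>j\<le>n. of_int (f j) * z ^ j) = 0}"
    proof (rule measure_pmf.finite_measure_mono)
      show "{f. m dvd int_rand_poly n f} \<subseteq> {f. (\<Sum>j\<le>n. of_int (f j) * z ^ j) = 0}"
        using z(2) by (auto simp: cpoly_mult elim!: dvdE simp flip: poly_cpoly_int_rand_poly)
    qed auto
    also have "\<dots> \<le> p ^ (n div (2 * k))"
      using k z0 zp by (intro prob_small_root_le[OF d p(1,3)]) auto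
    also have "\<dots> \<le> p ^ (n div (2 * D))"
      using k p by (intro power_decreasing div_le_mono2) auto
    finally show "measure_pmf.prob (coeff_law d n) {f. m dvd int_rand_poly n f} \<le> p ^ (n div (2 * D))" .
  qed (use p in auto)
qed (use p in auto)

text \<open>Count times A^(-2k) is 2 u^k with u = (6D + 1) / A^2, so the degrees from 3 on form a
  geometric series with leading term u^3, doubled at most because u <= 1/2. The last summand
  collects the Fourier errors.\<close>

lemma prob_square_factor_event_le:
  fixes d :: "int pmf"
  assumes d: "set_pmf d \<subseteq> {-1, 0, 1}"
    and char: "\<And>t. norm (measure_pmf.expectation d (\<lambda>x. cis (of_int x * t))) \<le> exp (- \<kappa> * sin t ^ 2)"
    and \<kappa>: "\<kappa> > 0" and A: "odd A" and u: "(6 * real D + 1) / real A ^ 2 \<le> 1 / 2"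
  shows "measure_pmf.prob (coeff_law d n) (square_factor_event n D)
    \<le> 4 * ((6 * real D + 1) / real A ^ 2) ^ 3 +
      real D * (2 * (6 * real D + 1) ^ D * exp (- \<kappa> * (real ((n + 1) div (2 * D)) / real A ^ 2)))"
proof -
  define u where "u = (6 * real D + 1) / real A ^ 2"
  define X where "X = exp (- \<kappa> * (real ((n + 1) div (2 * D)) / real A ^ 2))"
  have A0: "A > 0" using A by (rule odd_pos)
  have u0: "0 \<le> u" "u \<le> 1 / 2" using u by (simp_all add: u_def)
  have "measure_pmf.prob (coeff_law d n) (square_factor_event n D)
    \<le> (\<Sum>k\<in>{3..<D}. 2 * u ^ k + 2 * (6 * real D + 1) ^ D * X)"
    unfolding square_factor_event_def
  proof (rule prob_UN_le)
    fix k assume k: "k \<in> {3..<D}"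
    define M where "M = {m. unit_poly m \<and> degree m = k \<and> (\<forall>z. poly (cpoly m) z = 0 \<longrightarrow> 1 / (1 + 1 / real k) \<le> norm z)}"
    define T where "T = {m :: int poly. degree m = k \<and> \<bar>coeff m 0\<bar> = 1 \<and>
      (\<forall>z. poly (cpoly m) z = 0 \<longrightarrow> 1 / (1 + 1 / real k) \<le> norm z)}"
    have sub: "M \<subseteq> T" by (auto simp: M_def T_def unit_poly_def)
    have "real k * (1 + 1 / real k) ^ k \<le> real (3 * k)"
      using mult_left_mono[OF one_plus_inverse_power_le_3[of k], of "real k"] k by simp
    then have T: "finite T" "card T \<le> 2 * (2 * (3 * k) + 1) ^ k"
      using card_unit_polys_le[of "1 + 1 / real k" k "3 * k", folded T_def] by simp_all
    have "measure_pmf.prob (coeff_law d n) (\<Union>m\<in>M. {f. m ^ 2 dvd int_rand_poly n f})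
      \<le> 2 * (6 * real D + 1) ^ k * (1 / real A ^ (2 * k) + X)"
    proof (rule prob_UN_card_le)
      show "finite M" using sub T(1) by (rule finite_subset)
      have "card M \<le> 2 * (2 * (3 * k) + 1) ^ k" using card_mono[OF T(1) sub] T(2) by linarith
      also have "\<dots> \<le> 2 * (6 * D + 1) ^ k"
        using k by (intro mult_le_mono2 power_mono) auto
      finally have "real (card M) \<le> real (2 * (6 * D + 1) ^ k)" by (simp only: of_nat_le_iff)
      then show "real (card M) \<le> 2 * (6 * real D + 1) ^ k" by (simp add: add.commute)
      fix m assume "m \<in> M"
      then have m: "unit_poly m" "degree m = k" by (auto simp: M_def)
      have "m \<noteq> 0" using m(1) by (auto simp: unit_poly_def)
      then have deg: "degree (m ^ 2) = 2 * k" using m(2) by (simp add: degree_mult_eq power2_eq_square)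
      have "measure_pmf.prob (coeff_law d n) {f. m ^ 2 dvd int_rand_poly n f}
        \<le> 1 / real A ^ degree (m ^ 2) + exp (- \<kappa> * (real ((n + 1) div degree (m ^ 2)) / real A ^ 2))"
      proof (rule prob_dvd_le[OF d char \<kappa> _ _ A])
        show "lead_coeff (m ^ 2) = 1" using m(1) by (simp only: lead_coeff_power unit_poly_def power_one)
        have "\<bar>coeff (m ^ 2) 0\<bar> = \<bar>coeff m 0\<bar> * \<bar>coeff m 0\<bar>"
          by (simp add: power2_eq_square coeff_mult abs_mult)
        moreover have "\<bar>coeff m 0\<bar> = 1" using m(1) by (simp add: unit_poly_def)
        ultimately show "\<bar>coeff (m ^ 2) 0\<bar> = 1" by (simp only: mult_1)
      qed
      also have "\<dots> \<le> 1 / real A ^ (2 * k) + X"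
        unfolding deg X_def using k \<kappa>
        by (auto intro!: mult_left_mono divide_right_mono div_le_mono2)
      finally show "measure_pmf.prob (coeff_law d n) {f. m ^ 2 dvd int_rand_poly n f}
        \<le> 1 / real A ^ (2 * k) + X" .
    qed (auto simp: X_def)
    also have "\<dots> = 2 * u ^ k + 2 * (6 * real D + 1) ^ k * X"
      by (simp add: u_def power_divide distrib_left flip: power_mult)
    also have "\<dots> \<le> 2 * u ^ k + 2 * (6 * real D + 1) ^ D * X"
      using k by (intro add_left_mono mult_right_mono mult_left_mono power_increasing) (auto simp: X_def)
    finally show "measure_pmf.prob (coeff_law d n) (\<Union>m\<in>M. {f. m ^ 2 dvd int_rand_poly n f})
      \<le> 2 * u ^ k + 2 * (6 * real D + 1) ^ D * X" .
  qed auto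
  also have "\<dots> = 2 * (\<Sum>k\<in>{3..<D}. u ^ k) + real (D - 3) * (2 * (6 * real D + 1) ^ D * X)"
    by (simp add: sum.distrib sum_distrib_left)
  also have "(\<Sum>k\<in>{3..<D}. u ^ k) \<le> 2 * u ^ 3"
  proof -
    have "(\<Sum>k\<in>{3..<D}. u ^ k) \<le> (\<Sum>k\<in>{3..D}. u ^ k)" using u0 by (intro sum_mono2) auto
    also have "\<dots> \<le> u ^ 3 / (1 - u)" using u0 by (auto simp: sum_gp intro!: divide_right_mono)
    also have "\<dots> \<le> u ^ 3 / (1 / 2)" using u0 by (intro divide_left_mono) auto
    finally show ?thesis by simp
  qed
  also have "real (D - 3) * (2 * (6 * real D + 1) ^ D * X) \<le> real D * (2 * (6 * real D + 1) ^ D * X)"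
    by (intro mult_right_mono) (auto simp: X_def)
  finally show ?thesis by (simp add: u_def X_def)
qed

lemma prob_quadratic_event_le:
  fixes d :: "int pmf"
  assumes d: "set_pmf d \<subseteq> {-1, 0, 1}"
    and char: "\<And>t. norm (measure_pmf.expectation d (\<lambda>x. cis (of_int x * t))) \<le> exp (- \<kappa> * sin t ^ 2)"
    and \<kappa>: "\<kappa> > 0" and A: "odd A" "A \<ge> 3" and M: "coprime M 6" "12 * M \<le> n"
  shows "measure_pmf.prob (coeff_law d n) (quadratic_event n)
    \<le> 3 * (1 / (real A ^ 2 * real M ^ 2) + exp (- \<kappa> * (real M / real A ^ 2)))"
  unfolding quadratic_event_def
  by (intro prob_UN_card_le prob_quadratic_square_dvd_le[OF d char \<kappa> _ A M]) (auto simp: card_insert_if)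

lemma prob_double_root_outside_le:
  fixes d :: "int pmf"
  assumes d: "set_pmf d \<subseteq> {-1, 0, 1}"
    and p: "\<And>x. pmf d x \<le> p" "0 < p" "sqrt 3 * p < 1"
    and char: "\<And>t. norm (measure_pmf.expectation d (\<lambda>x. cis (of_int x * t))) \<le> exp (- \<kappa> * sin t ^ 2)"
    and \<kappa>: "\<kappa> > 0" and D: "D = 3 * J0" and A: "odd A" "(6 * real D + 1) / real A ^ 2 \<le> 1 / 2"
    and A': "odd A'" "A' \<ge> 3" and M: "coprime M 6" "12 * M \<le> n"
  shows "measure_pmf.prob (coeff_law d n) {f. \<exists>z::complex. double_root (rand_poly n f) z}
       - measure_pmf.prob (coeff_law d n) {f. \<exists>z\<in>{-1, 0, 1::complex}. double_root (rand_poly n f) z} \<le>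
     sqrt 3 * ((sqrt 3 * p) ^ J0 / (1 - sqrt 3 * p))
     + real D * (2 * (2 * real D * 2 ^ D + 1) ^ D * p ^ (n div (2 * D)))
     + (4 * ((6 * real D + 1) / real A ^ 2) ^ 3
        + real D * (2 * (6 * real D + 1) ^ D * exp (- \<kappa> * (real ((n + 1) div (2 * D)) / real A ^ 2))))
     + 3 * (1 / (real A' ^ 2 * real M ^ 2) + exp (- \<kappa> * (real M / real A' ^ 2)))" (is "_ \<le> ?R")
proof -
  let ?P = "measure_pmf.prob (coeff_law d n)"
  let ?E1 = "{f. \<exists>z::complex. double_root (rand_poly n f) z}"
  let ?E2 = "{f. \<exists>z\<in>{-1, 0, 1::complex}. double_root (rand_poly n f) z}"
  let ?S1 = "large_square_event n J0" and ?S2 = "small_root_event n D"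
  let ?S3 = "square_factor_event n D" and ?S4 = "quadratic_event n"
  have "1 * p \<le> sqrt 3 * p" using p by (intro mult_right_mono) auto
  then have p1: "p \<le> 1" using p by linarith
  have "?P ?E1 - ?P ?E2 = ?P (?E1 - ?E2)"
    by (rule measure_pmf.finite_measure_Diff[symmetric]) auto
  \<comment> \<open>The covering by the four events holds only for coefficients in {-1, 0, 1}, hence
    the restriction to the support.\<close>
  also have "\<dots> = ?P ((?E1 - ?E2) \<inter> set_pmf (coeff_law d n))" by (simp add: measure_Int_set_pmf)
  also have "\<dots> \<le> ?P (?S1 \<union> ?S2 \<union> ?S3 \<union> ?S4)"
  proof (rule measure_pmf.finite_measure_mono)
    show "(?E1 - ?E2) \<inter> set_pmf (coeff_law d n) \<subseteq> ?S1 \<union> ?S2 \<union> ?S3 \<union> ?S4"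
    proof
      fix f assume f: "f \<in> (?E1 - ?E2) \<inter> set_pmf (coeff_law d n)"
      then obtain z where "double_root (rand_poly n f) z" by blast
      moreover have "f j \<in> {-1, 0, 1}" for j using coeff_law_supp(1)[OF d] f by blast
      moreover have "\<not> (\<exists>z\<in>{-1, 0, 1}. double_root (rand_poly n f) z)" using f by blast
      ultimately show "f \<in> ?S1 \<union> ?S2 \<union> ?S3 \<union> ?S4" unfolding D by (intro double_root_event_cover) auto
    qed
  qed auto
  also have "\<dots> \<le> ?P ?S1 + ?P ?S2 + ?P ?S3 + ?P ?S4"
    by (intro order_trans[OF measure_Un_le] add_mono order_refl) auto
  also have "\<dots> \<le> ?R"
    using p p1 by (intro add_mono prob_large_square_le prob_small_root_event_le prob_square_factor_event_le
        prob_quadratic_event_le d char \<kappa> A A' M) auto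
  finally show ?thesis .
qed

section \<open>Choice of the parameters and asymptotics\<close>

lemma square_rounding_bounds:
  fixes x :: real
  assumes "x \<ge> 1"
  defines "A \<equiv> 2 * nat \<lfloor>x\<rfloor> + 1"
  shows "odd A" "A \<ge> 3" "x ^ 2 \<le> real A ^ 2" "real A ^ 2 \<le> 9 * x ^ 2"
proof -
  have "\<lfloor>x\<rfloor> \<ge> 1" using assms(1) by simp
  then have "nat \<lfloor>x\<rfloor> \<ge> 1" by linarith
  then show "odd A" "A \<ge> 3" by (simp_all add: A_def)
  have rA: "real A = 2 * of_int \<lfloor>x\<rfloor> + 1" using \<open>\<lfloor>x\<rfloor> \<ge> 1\<close> by (simp add: A_def)
  have "x \<le> real A" "real A \<le> 3 * x" unfolding rA using assms(1) by linarith+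
  then have "x ^ 2 \<le> real A ^ 2" "real A ^ 2 \<le> (3 * x) ^ 2"
    using assms(1) by (intro power_mono; linarith)+
  then show "x ^ 2 \<le> real A ^ 2" "real A ^ 2 \<le> 9 * x ^ 2" by (simp_all add: power_mult_distrib)
qed

lemma real_div_ge: "real a / real b - 1 \<le> real (a div b)"
proof (cases "b = 0")
  case False
  have "real a = real (a div b) * real b + real (a mod b)"
    by (metis of_nat_add of_nat_mult div_mult_mod_eq)
  moreover have "real (a mod b) \<le> real b" using False by (simp add: less_imp_le)
  ultimately show ?thesis using False by (simp add: field_simps)
qed simp

text \<open>With y of order ln n both counts become exp(O((ln n)^2)), negligible against the
  exponential decay that multiplies them.\<close>

lemma poly_count_bounds:
  fixes D :: nat and y :: real
  assumes "D > 0" "real D \<le> y"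
  shows "(2 * real D * 2 ^ D + 1) ^ D \<le> exp (3 * y ^ 2)" "(6 * real D + 1) ^ D \<le> exp (6 * y ^ 2)"
proof -
  have y: "real D ^ 2 \<le> y ^ 2" using assms by (intro power_mono) auto
  have "(6 * real D + 1) ^ D \<le> exp (6 * real D) ^ D"
    using exp_ge_add_one_self[of "6 * real D"] by (intro power_mono) (auto simp: add.commute)
  also have "\<dots> = exp (6 * real D ^ 2)" by (simp add: power2_eq_square mult_ac flip: exp_of_nat_mult)
  finally show "(6 * real D + 1) ^ D \<le> exp (6 * y ^ 2)" using y by (meson exp_le_cancel_iff mult_left_mono order_trans zero_le_numeral)
  have "2 * real D \<le> exp (real D)"
  proof -
    have "0 \<le> (real D - 1) ^ 2" by simp
    then have "2 * real D \<le> 1 + real D + real D ^ 2 / 2" by (simp add: power2_eq_square algebra_simps)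
    then show ?thesis using exp_lower_Taylor_quadratic[of "real D"] by simp
  qed
  moreover have "(2::real) ^ D \<le> exp (real D)"
  proof -
    have "(2::real) ^ D \<le> exp 1 ^ D" using exp_ge_add_one_self[of 1] by (intro power_mono) auto
    then show ?thesis by (simp flip: exp_of_nat_mult)
  qed
  ultimately have "2 * real D * 2 ^ D \<le> exp (real D) * exp (real D)" by (intro mult_mono) auto
  moreover have "1 \<le> exp (real D) * exp (real D)" by (simp flip: exp_add)
  ultimately have "2 * real D * 2 ^ D + 1 \<le> 2 * (exp (real D) * exp (real D))" by linarith
  also have "\<dots> \<le> exp (real D) * (exp (real D) * exp (real D))"
  proof (intro mult_right_mono)
    show "2 \<le> exp (real D)" using exp_ge_add_one_self[of "real D"] assms(1) by linarith
  qed auto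
  also have "\<dots> = exp (3 * real D)" by (simp flip: exp_add)
  finally have "(2 * real D * 2 ^ D + 1) ^ D \<le> exp (3 * real D) ^ D" by (intro power_mono) auto
  also have "\<dots> = exp (3 * real D ^ 2)" by (simp add: power2_eq_square mult_ac flip: exp_of_nat_mult)
  finally show "(2 * real D * 2 ^ D + 1) ^ D \<le> exp (3 * y ^ 2)" using y by (meson exp_le_cancel_iff mult_left_mono order_trans zero_le_numeral)
qed

lemma atom_bounds:
  fixes d :: "int pmf"
  assumes d: "set_pmf d \<subseteq> {-1, 0, 1}" and lt: "\<forall>x\<in>{-1, 0, 1::int}. pmf d x < 1 / sqrt 3"
  obtains p where "\<And>x. pmf d x \<le> p" "0 < p" "sqrt 3 * p < 1"
proof -
  define p where "p = Max (pmf d ` {-1, 0, 1})"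
  have fin: "finite (pmf d ` {-1, 0, 1 :: int})" by simp
  have le: "pmf d x \<le> p" if "x \<in> {-1, 0, 1}" for x unfolding p_def using that by (intro Max_ge fin) blast
  have "p \<in> pmf d ` {-1, 0, 1}" unfolding p_def by (intro Max_in fin) auto
  then have "p < 1 / sqrt 3" using lt by blast
  then have "sqrt 3 * p < 1" by (simp add: field_simps)
  moreover have "0 < p"
  proof -
    obtain x where x: "x \<in> set_pmf d" using set_pmf_not_empty[of d] by blast
    then have "0 < pmf d x" by (rule pmf_positive)
    also have "pmf d x \<le> p" using x d by (intro le) blast
    finally show ?thesis .
  qed
  moreover have "pmf d x \<le> p" for x
  proof (cases "x \<in> set_pmf d")
    case True
    then show ?thesis using le d by blast
  next
    case False
    then show ?thesis using \<open>0 < p\<close> by (simp add: set_pmf_iff)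
  qed
  ultimately show ?thesis using that by blast
qed

theorem theorem1p1:
  fixes d :: "int pmf"
  assumes "set_pmf d \<subseteq> {-1, 0, 1}"
    and "\<forall>x\<in>{-1, 0, 1::int}. pmf d x < 1 / sqrt 3"
  shows "(\<lambda>n. real n ^ 2 *
            (measure_pmf.prob (coeff_law d n) {f. \<exists>z::complex. double_root (rand_poly n f) z}
           - measure_pmf.prob (coeff_law d n) {f. \<exists>z\<in>{-1, 0, 1::complex}. double_root (rand_poly n f) z}))
         \<longlonglongrightarrow> 0"
proof -
  define X where "X n = measure_pmf.prob (coeff_law d n) {f. \<exists>z::complex. double_root (rand_poly n f) z}
           - measure_pmf.prob (coeff_law d n) {f. \<exists>z\<in>{-1, 0, 1::complex}. double_root (rand_poly n f) z}" for n
  obtain p where p: "\<And>x. pmf d x \<le> p" "0 < p" "sqrt 3 * p < 1" using atom_bounds[OF assms] by blast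
  have "1 * p < sqrt 3 * p" using p(2) by (intro mult_strict_right_mono) auto
  then have p1: "p < 1" using p(3) by linarith
  obtain \<kappa> where \<kappa>: "\<kappa> > 0"
    and char: "\<And>t. norm (measure_pmf.expectation d (\<lambda>x. cis (of_int x * t))) \<le> exp (- \<kappa> * sin t ^ 2)"
    using norm_char_le[OF assms(1)] p(1) p1 by (metis order_le_less_trans)
  have exp_anti: "exp (- \<kappa> * b) \<le> exp (- \<kappa> * a)" if "a \<le> b" for a b
    using that \<kappa> by simp
  define \<rho> where "\<rho> = sqrt 3 * p"
  have \<rho>: "0 < \<rho>" "\<rho> < 1" using p by (simp_all add: \<rho>_def)
  \<comment> \<open>Chosen so that \<rho>^(B ln n) = n^(-3).\<close>
  define B where "B = 3 / (- ln \<rho>)"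
  have B: "B > 0" using \<rho> by (simp add: B_def)
  define c where "c = - ln p"
  have c: "c > 0" using p p1 by (simp add: c_def)
  \<comment> \<open>An upper bound for D = 3 J0, since rounding up gives J0 <= B ln n + 1.\<close>
  define y where "y n = 3 * B * ln (real n) + 3" for n :: nat
  define T1 where "T1 n = sqrt 3 / (1 - \<rho>) * (1 / real n ^ 3)" for n :: nat
  define T2 where "T2 n = y n * (2 * exp (3 * y n ^ 2) * exp (- c * (real n / (2 * y n) - 1)))" for n
  define T3 where "T3 n = 4 * ((6 * y n + 1) / real n powr (4/5)) ^ 3" for n
  define T4 where "T4 n = y n * (2 * exp (6 * y n ^ 2) * exp (- \<kappa> * ((real n / (2 * y n) - 1) / (9 * real n powr (4/5)))))" for n
  define T5 where "T5 n = 3 * (1 / (real n powr (1/2) * (real n / 20) ^ 2) + exp (- \<kappa> * ((real n / 20) / (9 * real n powr (1/2)))))" for n :: nat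
  have "(\<lambda>n. real n ^ 2 * T1 n) \<longlonglongrightarrow> 0" unfolding T1_def by real_asymp
  moreover have "(\<lambda>n. real n ^ 2 * T2 n) \<longlonglongrightarrow> 0" unfolding T2_def y_def using B c by real_asymp
  moreover have "(\<lambda>n. real n ^ 2 * T3 n) \<longlonglongrightarrow> 0" unfolding T3_def y_def using B by real_asymp
  moreover have "(\<lambda>n. real n ^ 2 * T4 n) \<longlonglongrightarrow> 0" unfolding T4_def y_def using B \<kappa> by real_asymp
  moreover have "(\<lambda>n. real n ^ 2 * T5 n) \<longlonglongrightarrow> 0" unfolding T5_def using \<kappa> by real_asymp
  ultimately have "(\<lambda>n. real n ^ 2 * T1 n + real n ^ 2 * T2 n + real n ^ 2 * T3 n + real n ^ 2 * T4 n + real n ^ 2 * T5 n)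
      \<longlonglongrightarrow> 0 + 0 + 0 + 0 + 0" by (intro tendsto_add)
  then have lim: "(\<lambda>n. real n ^ 2 * (T1 n + T2 n + T3 n + T4 n + T5 n)) \<longlonglongrightarrow> 0"
    by (simp add: distrib_left)
  have ev1: "eventually (\<lambda>n. real n / (2 * y n) - 1 \<ge> 0) sequentially" unfolding y_def using B by real_asymp
  have ev2: "eventually (\<lambda>n. (6 * y n + 1) / real n powr (4/5) \<le> 1/2) sequentially"
    unfolding y_def using B by real_asymp
  have "eventually (\<lambda>n. X n \<le> T1 n + T2 n + T3 n + T4 n + T5 n) sequentially"
    \<comment> \<open>From 500 on, 6 (n/100 - 1) + 1 >= n/20, which is the lower bound for
      \<open>M\<close>.\<close>
    using ev1 ev2 eventually_ge_at_top[of 500]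
  proof eventually_elim
    case (elim n)
    have n: "n \<ge> 500" "real n \<ge> 500" using elim(3) by auto
    have ln: "ln (real n) > 0" using n by simp
    define J0 where "J0 = nat \<lceil>B * ln (real n)\<rceil>"
    define D where "D = 3 * J0"
    \<comment> \<open>Exponents strictly between 1/3 and 1/2 work: above 1/3, A^(-6) is o(n^(-2))
      even with logarithms; below 1/2, the Fourier error still beats the count.\<close>
    define A where "A = 2 * nat \<lfloor>real n powr (2/5)\<rfloor> + 1"
    \<comment> \<open>A positive exponent below 1/2: \<open>A'\<close> only has to gain a power of n
      on top of M^(-2), which is of order n^(-2).\<close>
    define A' where "A' = 2 * nat \<lfloor>real n powr (1/4)\<rfloor> + 1"
    \<comment> \<open>Congruent to 1 modulo 6, hence coprime to 6, and of order n with 12 M <=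
      n.\<close>
    define M where "M = 6 * (n div 100) + 1"
    have BL: "B * ln (real n) > 0" using B ln by simp
    have J0: "B * ln (real n) \<le> real J0" "real J0 \<le> B * ln (real n) + 1"
      unfolding J0_def using BL by linarith+
    have D: "D > 0" "real D \<le> y n" using J0 BL by (auto simp: D_def y_def)
    have ypos: "y n > 0" using D by linarith
    have nA: "real n powr (2/5) \<ge> 1" "real n powr (1/4) \<ge> 1" using n by (auto intro: ge_one_powr_ge_zero)
    have sq: "(real n powr (2/5)) ^ 2 = real n powr (4/5)" "(real n powr (1/4)) ^ 2 = real n powr (1/2)"
      by (simp_all add: power2_eq_square flip: powr_add)
    note A = square_rounding_bounds[OF nA(1), folded A_def, unfolded sq]
    note A' = square_rounding_bounds[OF nA(2), folded A'_def, unfolded sq]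
    have pw: "real n powr (4/5) > 0" "real n powr (1/2) > 0" using n by auto
    have u: "(6 * real D + 1) / real A ^ 2 \<le> (6 * y n + 1) / real n powr (4/5)"
      using D A pw by (intro frac_le) auto
    have M: "coprime M 6" "12 * M \<le> n" "real n / 20 \<le> real M"
    proof -
      have "gcd 6 (n div 100 * 6 + 1) = 1" by (simp only: gcd_add_mult) simp
      then show "coprime M 6" by (simp add: M_def coprime_iff_gcd_eq_1 gcd.commute mult.commute)
      have "n div 100 * 100 \<le> n" by simp
      moreover have "12 * (6 * q + 1) \<le> n" if "q * 100 \<le> n" for q :: nat
      proof -
        have "12 * (6 * q + 1) = 72 * q + 12" by simp
        then show ?thesis using that n(1) by linarith
      qed
      ultimately show "12 * M \<le> n" unfolding M_def by blast
      have "real M = 6 * real (n div 100) + 1" by (simp add: M_def)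
      moreover have "real n / 100 - 1 \<le> real (n div 100)" using real_div_ge[of n 100] by simp
      ultimately show "real n / 20 \<le> real M" using n(2) by linarith
    qed
    have b1: "sqrt 3 * ((sqrt 3 * p) ^ J0 / (1 - sqrt 3 * p)) \<le> T1 n"
    proof -
      have "\<rho> ^ J0 = \<rho> powr real J0" using \<rho> by (simp add: powr_realpow)
      also have "\<dots> \<le> \<rho> powr (B * ln (real n))" using J0 \<rho> by (intro powr_mono') auto
      also have "\<dots> = exp (- 3 * ln (real n))" using \<rho> by (simp add: powr_def B_def)
      also have "\<dots> = 1 / real n ^ 3" using n by (simp add: exp_minus exp_of_nat_mult[of 3, simplified] field_simps)
      finally have "\<rho> ^ J0 / (1 - \<rho>) \<le> (1 / real n ^ 3) / (1 - \<rho>)" using \<rho> by (intro divide_right_mono) auto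
      then have "sqrt 3 * (\<rho> ^ J0 / (1 - \<rho>)) \<le> sqrt 3 * ((1 / real n ^ 3) / (1 - \<rho>))" by (intro mult_left_mono) auto
      then show ?thesis by (simp add: T1_def \<rho>_def mult.commute)
    qed
    have divD: "real n / (2 * y n) - 1 \<le> real (n div (2 * D))"
    proof -
      have "real n / (2 * y n) \<le> real n / real (2 * D)" using D by (intro divide_left_mono) auto
      then show ?thesis using real_div_ge[of n "2 * D"] by linarith
    qed
    have b2: "real D * (2 * (2 * real D * 2 ^ D + 1) ^ D * p ^ (n div (2 * D))) \<le> T2 n"
    proof -
      have "p ^ (n div (2 * D)) = exp (- c * real (n div (2 * D)))"
        using p(2) by (simp add: c_def powr_realpow[symmetric] powr_def mult.commute)
      also have "\<dots> \<le> exp (- c * (real n / (2 * y n) - 1))" using divD c by simp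
      finally show ?thesis
        unfolding T2_def using D poly_count_bounds[OF D] p(2) ypos by (intro mult_mono mult_nonneg_nonneg) auto
    qed
    have b3: "4 * ((6 * real D + 1) / real A ^ 2) ^ 3 \<le> T3 n"
      unfolding T3_def by (intro mult_left_mono power_mono u) auto
    have b4: "real D * (2 * (6 * real D + 1) ^ D * exp (- \<kappa> * (real ((n + 1) div (2 * D)) / real A ^ 2))) \<le> T4 n"
    proof -
      have "real (n div (2 * D)) \<le> real ((n + 1) div (2 * D))" by (intro of_nat_mono div_le_mono) auto
      then have "real n / (2 * y n) - 1 \<le> real ((n + 1) div (2 * D))" using divD by linarith
      moreover have "0 < real A ^ 2" using A(2) by simp
      ultimately have "(real n / (2 * y n) - 1) / (9 * real n powr (4/5)) \<le> real ((n + 1) div (2 * D)) / real A ^ 2"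
        using elim(1) A(4) by (intro frac_le) auto
      then have "exp (- \<kappa> * (real ((n + 1) div (2 * D)) / real A ^ 2))
          \<le> exp (- \<kappa> * ((real n / (2 * y n) - 1) / (9 * real n powr (4/5))))"
        by (rule exp_anti)
      then show ?thesis
        unfolding T4_def using D poly_count_bounds[OF D] ypos by (intro mult_mono mult_nonneg_nonneg) auto
    qed
    have b5: "3 * (1 / (real A' ^ 2 * real M ^ 2) + exp (- \<kappa> * (real M / real A' ^ 2))) \<le> T5 n"
    proof -
      have "(real n / 20) / (9 * real n powr (1/2)) \<le> real M / real A' ^ 2"
        using M A' by (intro frac_le) auto
      then have "exp (- \<kappa> * (real M / real A' ^ 2)) \<le> exp (- \<kappa> * ((real n / 20) / (9 * real n powr (1/2))))"
        by (rule exp_anti)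
      moreover have "1 / (real A' ^ 2 * real M ^ 2) \<le> 1 / (real n powr (1/2) * (real n / 20) ^ 2)"
        using M A' pw n by (intro frac_le mult_mono power_mono mult_pos_pos) auto
      ultimately show ?thesis unfolding T5_def by (intro mult_left_mono add_mono) auto
    qed
    have "(6 * real D + 1) / real A ^ 2 \<le> 1 / 2" using u elim(2) by linarith
    from prob_double_root_outside_le[OF assms(1) p char \<kappa> D_def A(1) this A'(1,2) M(1,2)]
    show ?case using b1 b2 b3 b4 b5 unfolding X_def by linarith
  qed
  then have up: "eventually (\<lambda>n. real n ^ 2 * X n \<le> real n ^ 2 * (T1 n + T2 n + T3 n + T4 n + T5 n)) sequentially"
    by eventually_elim (intro mult_left_mono, auto)
  have "0 \<le> X n" for n
    unfolding X_def by (simp, intro measure_pmf.finite_measure_mono) auto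
  then have "eventually (\<lambda>n. 0 \<le> real n ^ 2 * X n) sequentially" by simp
  from tendsto_sandwich[OF this up tendsto_const lim] show ?thesis by (simp add: X_def)
qed

end
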